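(* Let $k$ be a field, $X=X_0\cup X_1$ a well-ordered set whose elements in $X_i$ have parity $i$, $X^{**}$ the set of all nonassociative terms over $X$, and $$S=\{(\mu(\nu\tau))-((\mu\nu)\tau)+(-1)^{|\nu||\tau|}((\mu\tau)\nu)\mid\mu,\nu,\tau\in X^{**}\}.$$ Then the following hold. (i) With respect to the order $<'$ on $X^{**}$ (defined in the context), the set $S$ is a Gröbner–Shirshov basis in the free nonassociative algebra $kX^{**}$. (ii) The set $\mathrm{NF}(X):=\{[a_1\cdots a_n]_L\mid a_i\in X,\ 1\le i\le n,\ n\ge1\}$ forms a linear basis of the free Leibniz superalgebra $\mathrm{Lb}_s(X)$.
   Context: Terms. $X^{**}$ is the set of nonassociative words (bracketed words) over $X$: each $a\in X$ is a term of length $\ell(a)=1$, and if $\mu_1,\mu_2$ are terms then $(\mu_1\mu_2)$ is a term of length $\ell(\mu_1)+\ell(\mu_2)$. $kX^{**}$ is the free nonassociative algebra on $X$, with basis $X^{**}$. Parity: $|a|=i$ for $a\in X_i$, $|(\mu_1\mu_2)|=|\mu_1|+|\mu_2|$ mod 2. $[f_1\cdots f_n]_L:=((\cdots((f_1f_2)f_3)\cdots)f_n)$, $[f_1]_L=f_1$. Free Leibniz superalgebra. A superalgebra $\mathcal A=\mathcal A_0\oplus\mathcal A_1$ (with $(\mathcal A_i\mathcal A_j)\subseteq\mathcal A_{i+j}$, indices mod 2) is a Leibniz superalgebra if $(x(yz))=((xy)z)-(-1)^{|z||y|}((xz)y)$ for all $x,y,z\in\mathcal A_0\cup\mathcal A_1$.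 $\mathrm{Lb}_s(X)=kX^{**}/\mathrm{Id}(S)$ is the free Leibniz superalgebra on $X$, where $\mathrm{Id}(S)$ is the two-sided ideal generated by $S$. Order. Every term is uniquely of the form $((\cdots((a\mu_1)\mu_2)\cdots)\mu_n)$ with $a\in X$, $n\geq 0$ and terms $\mu_i$ of length less than that of the whole term. For $\mu=((\cdots((a\mu_1)\mu_2)\cdots)\mu_n)$ and $\nu=((\cdots((b\nu_1)\nu_2)\cdots)\nu_m)$ written in this form (with $a,b\in X$ and $\mu_i,\nu_j\in X^{**}$), $\mu<'\nu$ iff $(\ell(\mu),\mu_n,\dots,\mu_1,a)<(\ell(\nu),\nu_m,\dots,\nu_1,b)$ lexicographically, where $\mu_i,\nu_j$ are compared inductively on length. This is a well order compatible with multiplication on both sides. For $0\ne f\in kX^{**}$, $\overline f$ is the largest term occurring in $f$, and $f$ is monic if its coefficient is $1$. Gröbner–Shirshov bases in $kX^{**}$. A star term is a term over $X\cup\{\star\}$ in which $\star\notin X$ occurs exactly once; $\mu_{\star\mapsto f}$ is obtained by replacing $\star$ by $f$. For a set $S$ of monic elements, and $f,g\in S$ with $\overline f=\overline{\mu_{\star\mapsto g}}$ for some star term $\mu$, the inclusion composition is $(f,g)_{\overline f}=f-\mu_{\star\mapsto g}$. $S$ is a Gröbner–Shirshov basis in $kX^{**}$ if every such inclusion composition can be written as $\sum\alpha_i(\mu_i)_{\star\mapsto s_i}$ with $\alpha_i\in k$, $\mu_i$ star terms, $s_i\in S$ and $\overline{(\mu_i)_{\star\mapsto s_i}}<'\overline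 f$. *)

theory Defs
  imports "Jordan_Normal_Form.VS_Connect" "HOL-Library.Poly_Mapping" "HOL-Algebra.QuotRing"
begin

datatype 'x nterm = Letter 'x | App "'x nterm" "'x nterm"

primrec len :: "'x nterm \<Rightarrow> nat" where
  "len (Letter a) = 1"
| "len (App \<mu> \<nu>) = len \<mu> + len \<nu>"

definition nterms :: "'x set \<Rightarrow> 'x nterm set" where
  "nterms X = {\<mu>. set_nterm \<mu> \<subseteq> X}"

text \<open>The parity of a term over \<open>X\<^sub>0 \<union> X\<^sub>1\<close>, for disjoint \<open>X\<^sub>0\<close> and \<open>X\<^sub>1\<close>;
  only the set \<open>X\<^sub>1\<close> of odd letters is passed.\<close>

primrec parity :: "'x set \<Rightarrow> 'x nterm \<Rightarrow> nat" where
  "parity X1 (Letter a) = (if a \<in> X1 then 1 else 0)"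
| "parity X1 (App \<mu> \<nu>) = (parity X1 \<mu> + parity X1 \<nu>) mod 2"

fun left_normed :: "'x nterm list \<Rightarrow> 'x nterm" where
  "left_normed [] = undefined"
| "left_normed (\<mu> # \<mu>s) = foldl App \<mu> \<mu>s"

definition NF :: "'x set \<Rightarrow> 'x nterm set" where
  "NF X = {left_normed (map Letter as) | as. as \<noteq> [] \<and> set as \<subseteq> X}"


text \<open>For \<open>\<mu> = ((\<dots>((a \<mu>\<^sub>1) \<mu>\<^sub>2)\<dots>) \<mu>\<^sub>n)\<close> this is the list \<open>[\<mu>\<^sub>n, \<dots>, \<mu>\<^sub>1, a]\<close>, with the letter \<open>a\<close>
  regarded as a term.\<close>

primrec spine :: "'x nterm \<Rightarrow> 'x nterm list" where
  "spine (Letter a) = [Letter a]"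
| "spine (App \<mu> \<nu>) = \<nu> # spine \<mu>"

lemma lexord_mono' [mono]:
  "(\<And>x y. R x y \<longrightarrow> Q x y) \<Longrightarrow>
    (xs, ys) \<in> lexord {(x, y). R x y} \<longrightarrow> (xs, ys) \<in> lexord {(x, y). Q x y}"
  unfolding lexord_def by blast

text \<open>The order \<open><'\<close>: lexicographic comparison of \<open>(\<ell>(\<mu>), \<mu>\<^sub>n, \<dots>, \<mu>\<^sub>1, a)\<close>.  Two spines of terms of
  the same length are never proper prefixes of each other, and when the comparison reaches the
  final letter of one of them it has reached the final letter of the other one as well.\<close>

inductive nless :: "'x::wellorder nterm \<Rightarrow> 'x nterm \<Rightarrow> bool" where
  letter: "a < b \<Longrightarrow> nless (Letter a) (Letter b)"
| length: "len \<mu> < len \<nu> \<Longrightarrow> nless \<mu> \<nu>"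
| lex: "len \<mu> = len \<nu> \<Longrightarrow> (spine \<mu>, spine \<nu>) \<in> lexord {(x, y). nless x y} \<Longrightarrow> nless \<mu> \<nu>"

lemma len_pos: "0 < len \<mu>"
  by (induction \<mu>) auto

lemma nless_Letter [simp]: "nless (Letter a) (Letter b) \<longleftrightarrow> a < b"
proof
  assume "nless (Letter a) (Letter b)"
  then show "a < b"
    by (induction "Letter a" "Letter b") auto
qed (rule nless.letter)

lemma spine_len: "sum_list (map len (spine \<mu>)) = len \<mu>" by (induction \<mu>) auto

lemma nless_len: "nless \<mu> \<nu> \<Longrightarrow> len \<mu> \<le> len \<nu>"
  by (erule nless.cases) auto

lemma nless_App: "nless (App \<mu> \<nu>) (App \<mu>' \<nu>') \<longleftrightarrow> len (App \<mu> \<nu>) < len (App \<mu>' \<nu>') \<or>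
  len (App \<mu> \<nu>) = len (App \<mu>' \<nu>') \<and> (nless \<nu> \<nu>' \<or> \<nu> = \<nu>' \<and> (spine \<mu>, spine \<mu>') \<in> lexord {(x,y). nless x y})"
  by (subst nless.simps) auto

lemma spine_lex: "len \<mu> = len \<nu> \<Longrightarrow> (spine \<mu>, spine \<nu>) \<in> lexord {(x,y). nless x y} \<longleftrightarrow> nless \<mu> \<nu>"
proof (cases \<mu>; cases \<nu>)
  fix a b assume "\<mu> = Letter a" "\<nu> = Letter b" then show ?thesis by simp
next
  fix a b c assume "len \<mu> = len \<nu>" "\<mu> = Letter a" "\<nu> = App b c" then show ?thesis
    using len_pos[of b] len_pos[of c] by simp
next
  fix a b c assume "len \<mu> = len \<nu>" "\<nu> = Letter a" "\<mu> = App b c" then show ?thesis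
    using len_pos[of b] len_pos[of c] by simp
next
  fix a b c d assume "len \<mu> = len \<nu>" "\<nu> = App a d" "\<mu> = App b c" then show ?thesis
    by (simp add: nless_App)
qed

lemma nless_App': "nless (App \<mu> \<nu>) (App \<mu>' \<nu>') \<longleftrightarrow> len (App \<mu> \<nu>) < len (App \<mu>' \<nu>') \<or>
  len (App \<mu> \<nu>) = len (App \<mu>' \<nu>') \<and> (nless \<nu> \<nu>' \<or> \<nu> = \<nu>' \<and> nless \<mu> \<mu>')"
  unfolding nless_App by (auto simp: spine_lex)

lemma nless_Letter_App: "nless (Letter a) (App \<mu> \<nu>)"
  using len_pos[of \<mu>] len_pos[of \<nu>] by (intro nless.length) simp

lemma nless_App_Letter: "\<not> nless (App \<mu> \<nu>) (Letter a)"
  using len_pos[of \<mu>] len_pos[of \<nu>] nless_len[of "App \<mu> \<nu>" "Letter a"] by auto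

lemma nless_irrefl: "\<not> nless \<mu> \<mu>"
  by (induction \<mu>) (auto simp: nless_App')

lemma nless_total: "nless \<mu> \<nu> \<or> \<mu> = \<nu> \<or> nless \<nu> \<mu>"
  apply (induction \<mu> arbitrary: \<nu>)
  subgoal for a \<nu> by (cases \<nu>) (auto simp: nless_Letter_App)
  subgoal for b c \<nu> by (cases \<nu>) (auto simp: nless_Letter_App nless_App' | metis nat_neq_iff)+
  done

lemma nless_trans: "nless \<mu> \<nu> \<Longrightarrow> nless \<nu> \<tau> \<Longrightarrow> nless \<mu> \<tau>"
proof (induction \<mu> arbitrary: \<nu> \<tau>)
  case (Letter x)
  then show ?case
    by (cases \<nu>; cases \<tau>) (auto simp: nless_Letter_App nless_App_Letter)
next
  case (App a b)
  then obtain c d e f where [simp]: "\<nu> = App c d" "\<tau> = App e f"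
    by (cases \<nu>; cases \<tau>) (auto simp: nless_Letter_App nless_App_Letter)
  show ?case using App.prems App.IH(1)[of c e] App.IH(2)[of d f] by (auto simp: nless_App')
qed


type_synonym ('k, 'x) nalg = "'x nterm \<Rightarrow>\<^sub>0 'k"

definition nmult :: "('k::field, 'x) nalg \<Rightarrow> ('k, 'x) nalg \<Rightarrow> ('k, 'x) nalg" where
  "nmult f g = (\<Sum>\<mu>\<in>Poly_Mapping.keys f. \<Sum>\<nu>\<in>Poly_Mapping.keys g.
     Poly_Mapping.single (App \<mu> \<nu>) (Poly_Mapping.lookup f \<mu> * Poly_Mapping.lookup g \<nu>))"

definition nscale :: "'k::field \<Rightarrow> ('k, 'x) nalg \<Rightarrow> ('k, 'x) nalg" where
  "nscale c f = Poly_Mapping.map ((*) c) f"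

text \<open>The free nonassociative algebra \<open>kX\<^sup>*\<^sup>*\<close>.  It has no unit, so the field \<open>one\<close> of the record
  carries no meaning here and in quotients.\<close>

definition free_nalg :: "'x set \<Rightarrow> ('k::field, ('k, 'x) nalg) module" where
  "free_nalg X = \<lparr>carrier = {f. Poly_Mapping.keys f \<subseteq> nterms X}, mult = nmult, one = undefined,
     zero = 0, add = (+), smult = nscale\<rparr>"

definition two_sided_ideal :: "('k::field, 'v) module \<Rightarrow> 'v set \<Rightarrow> bool" where
  "two_sided_ideal A I \<longleftrightarrow> subspace class_ring I A \<and>
     (\<forall>a\<in>carrier A. \<forall>x\<in>I. a \<otimes>\<^bsub>A\<^esub> x \<in> I \<and> x \<otimes>\<^bsub>A\<^esub> a \<in> I)"

definition generated_ideal :: "('k::field, 'v) module \<Rightarrow> 'v set \<Rightarrow> 'v set" where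
  "generated_ideal A S = two_sided_ideal A hull S"

definition quotient_nalg :: "('k::field, 'v) module \<Rightarrow> 'v set \<Rightarrow> ('k, 'v set) module" where
  "quotient_nalg A I = \<lparr>carrier = a_rcosets\<^bsub>A\<^esub> I, mult = rcoset_mult A I, one = undefined,
     zero = I, add = set_add A, smult = (\<lambda>c C. \<Union>x\<in>C. I +>\<^bsub>A\<^esub> (c \<odot>\<^bsub>A\<^esub> x))\<rparr>"


text \<open>Star terms are terms over \<open>X \<union> {\<star>}\<close>, with \<open>None\<close> in the role of \<open>\<star>\<close>.\<close>

primrec occurrences :: "'x nterm \<Rightarrow> 'x \<Rightarrow> nat" where
  "occurrences (Letter a) b = (if a = b then 1 else 0)"
| "occurrences (App \<mu> \<nu>) b = occurrences \<mu> b + occurrences \<nu> b"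

definition star_terms :: "'x set \<Rightarrow> 'x option nterm set" where
  "star_terms X = {\<mu> \<in> nterms (insert None (Some ` X)). occurrences \<mu> None = 1}"

primrec star_subst :: "'x option nterm \<Rightarrow> ('k::field, 'x) nalg \<Rightarrow> ('k, 'x) nalg" where
  "star_subst (Letter z) f = (case z of None \<Rightarrow> f | Some a \<Rightarrow> Poly_Mapping.single (Letter a) 1)"
| "star_subst (App \<mu> \<nu>) f = nmult (star_subst \<mu> f) (star_subst \<nu> f)"

definition leading_term :: "('x nterm \<Rightarrow> 'x nterm \<Rightarrow> bool) \<Rightarrow> ('k::field, 'x) nalg \<Rightarrow> 'x nterm" where
  "leading_term lt f = (THE \<mu>. \<mu> \<in> Poly_Mapping.keys f \<and>
     (\<forall>\<nu>\<in>Poly_Mapping.keys f. \<nu> \<noteq> \<mu> \<longrightarrow> lt \<nu> \<mu>))"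

definition nmonic :: "('x nterm \<Rightarrow> 'x nterm \<Rightarrow> bool) \<Rightarrow> ('k::field, 'x) nalg \<Rightarrow> bool" where
  "nmonic lt f \<longleftrightarrow> f \<noteq> 0 \<and> Poly_Mapping.lookup f (leading_term lt f) = 1"

definition gs_basis ::
  "('x nterm \<Rightarrow> 'x nterm \<Rightarrow> bool) \<Rightarrow> 'x set \<Rightarrow> ('k::field, 'x) nalg set \<Rightarrow> bool" where
  "gs_basis lt X S \<longleftrightarrow>
     S \<subseteq> carrier (free_nalg X) \<and> (\<forall>s\<in>S. nmonic lt s) \<and>
     (\<forall>f\<in>S. \<forall>g\<in>S. \<forall>\<mu>\<in>star_terms X.
        leading_term lt f = leading_term lt (star_subst \<mu> g) \<longrightarrow>
        (\<exists>(n::nat) \<alpha> \<nu> s.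
           (\<forall>i<n. \<nu> i \<in> star_terms X \<and> s i \<in> S \<and>
              lt (leading_term lt (star_subst (\<nu> i) (s i))) (leading_term lt f)) \<and>
           f - star_subst \<mu> g = (\<Sum>i<n. nscale (\<alpha> i) (star_subst (\<nu> i) (s i)))))"


definition leibniz_rels :: "'x set \<Rightarrow> 'x set \<Rightarrow> ('k::field, 'x) nalg set" where
  "leibniz_rels X0 X1 =
     {Poly_Mapping.single (App \<mu> (App \<nu> \<tau>)) 1
        - Poly_Mapping.single (App (App \<mu> \<nu>) \<tau>) 1
        + Poly_Mapping.single (App (App \<mu> \<tau>) \<nu>) ((-1) ^ (parity X1 \<nu> * parity X1 \<tau>))
      | \<mu> \<nu> \<tau>. \<mu> \<in> nterms (X0 \<union> X1) \<and> \<nu> \<in> nterms (X0 \<union> X1) \<and> \<tau> \<in> nterms (X0 \<union> X1)}"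

definition leibniz_ideal :: "'x set \<Rightarrow> 'x set \<Rightarrow> ('k::field, 'x) nalg set" where
  "leibniz_ideal X0 X1 = generated_ideal (free_nalg (X0 \<union> X1)) (leibniz_rels X0 X1)"

definition Lbs :: "'x set \<Rightarrow> 'x set \<Rightarrow> ('k::field, ('k, 'x) nalg set) module" where
  "Lbs X0 X1 = quotient_nalg (free_nalg (X0 \<union> X1)) (leibniz_ideal X0 X1)"

text \<open>The image of a term under the projection \<open>kX\<^sup>*\<^sup>* \<rightarrow> Lb\<^sub>s(X)\<close>.\<close>

definition Lbs_class :: "'x set \<Rightarrow> 'x set \<Rightarrow> 'x nterm \<Rightarrow> ('k::field, 'x) nalg set" where
  "Lbs_class X0 X1 \<mu> =
     leibniz_ideal X0 X1 +>\<^bsub>free_nalg (X0 \<union> X1) :: ('k, ('k, 'x) nalg) module\<^esub> Poly_Mapping.single \<mu> 1"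


lemma lookup_nscale [simp]: "Poly_Mapping.lookup (nscale c f) \<mu> = c * Poly_Mapping.lookup f \<mu>"
  by (auto simp: nscale_def map.rep_eq when_def)

lemma vectorspace_free_nalg:
  "vectorspace class_ring (free_nalg X :: ('k::field, ('k, 'x) nalg) module)" (is "vectorspace _ ?A")
proof -
  have keys_neg: "Poly_Mapping.keys (- f) = Poly_Mapping.keys f" for f :: "('k, 'x) nalg"
    by (auto simp: in_keys_iff)
  have "abelian_group ?A"
  proof (rule abelian_groupI)
    fix x assume "x \<in> carrier ?A"
    then show "\<exists>y\<in>carrier ?A. y \<oplus>\<^bsub>?A\<^esub> x = \<zero>\<^bsub>?A\<^esub>"
      by (intro bexI[of _ "- x"]) (auto simp: free_nalg_def keys_neg)
  qed (use Poly_Mapping.keys_add in \<open>fastforce simp: free_nalg_def ac_simps\<close>)+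
  moreover have "Poly_Mapping.keys (nscale c f) \<subseteq> Poly_Mapping.keys f" for c :: 'k and f :: "('k, 'x) nalg"
    by (auto simp: in_keys_iff)
  ultimately have "Module.module class_ring ?A"
    by (intro Module.module.intro Module.module_axioms.intro class_cring.is_cring)
       (auto simp: free_nalg_def algebra_simps lookup_add intro!: poly_mapping_eqI)
  then show ?thesis by (simp add: vectorspace_def class_field)
qed


lemma vectorspace_quotient:
  fixes A :: "('k::field, 'v) module"
  assumes "subspace class_ring I A"
  shows "vectorspace class_ring (quotient_nalg A I)"
    and "\<And>x y. x \<in> carrier A \<Longrightarrow> y \<in> carrier A \<Longrightarrow> I +>\<^bsub>A\<^esub> x = I +>\<^bsub>A\<^esub> y \<longleftrightarrow> x \<ominus>\<^bsub>A\<^esub> y \<in> I"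
    and "\<And>c x. x \<in> carrier A \<Longrightarrow> c \<odot>\<^bsub>quotient_nalg A I\<^esub> (I +>\<^bsub>A\<^esub> x) = I +>\<^bsub>A\<^esub> (c \<odot>\<^bsub>A\<^esub> x)"
proof -
  interpret A: vectorspace class_ring A using assms by (simp add: subspace_def)
  interpret I: LinearCombinations.submodule class_ring I A using assms by (simp add: subspace_def)
  have neg: "\<ominus>\<^bsub>A\<^esub> x \<in> I" if "x \<in> I" for x
  proof -
    have "x \<in> carrier A" using that I.subset by blast
    moreover have "\<ominus>\<^bsub>class_ring\<^esub> (1::'k) = -1" by (simp add: class_ring_simps)
    moreover have "(-1) \<odot>\<^bsub>A\<^esub> x \<in> I" using I.smult_closed[of "-1" x] that by simp
    moreover note A.smult_minus_1[of x]
    ultimately show ?thesis by simp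
  qed
  have sg: "additive_subgroup I A"
    by (rule additive_subgroup.intro, rule subgroup.intro) (use I.subset neg in \<open>simp_all add: a_inv_def\<close>)
  interpret Q: abelian_subgroup I A
    by (rule abelian_subgroupI3[OF sg A.abelian_group_axioms])
  let ?Q = "quotient_nalg A I"
  show eq: "I +>\<^bsub>A\<^esub> x = I +>\<^bsub>A\<^esub> y \<longleftrightarrow> x \<ominus>\<^bsub>A\<^esub> y \<in> I" if "x \<in> carrier A" "y \<in> carrier A" for x y
  proof
    assume "I +>\<^bsub>A\<^esub> x = I +>\<^bsub>A\<^esub> y"
    then have "x \<in> I +>\<^bsub>A\<^esub> y" using Q.a_rcos_self[OF that(1)] by simp
    then show "x \<ominus>\<^bsub>A\<^esub> y \<in> I" using Q.a_rcos_module[OF that(2,1)] by (simp add: A.minus_eq)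
  next
    assume "x \<ominus>\<^bsub>A\<^esub> y \<in> I"
    then have "x \<in> I +>\<^bsub>A\<^esub> y" using Q.a_rcos_module[OF that(2,1)] by (simp add: A.minus_eq)
    then show "I +>\<^bsub>A\<^esub> x = I +>\<^bsub>A\<^esub> y"
      using A.a_repr_independence[OF _ that(2) Q.a_subgroup] by blast
  qed
  show smu: "c \<odot>\<^bsub>?Q\<^esub> (I +>\<^bsub>A\<^esub> x) = I +>\<^bsub>A\<^esub> (c \<odot>\<^bsub>A\<^esub> x)" if "x \<in> carrier A" for c x
  proof -
    have "I +>\<^bsub>A\<^esub> (c \<odot>\<^bsub>A\<^esub> y) = I +>\<^bsub>A\<^esub> (c \<odot>\<^bsub>A\<^esub> x)" if y: "y \<in> I +>\<^bsub>A\<^esub> x" for y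
    proof -
      have yc: "y \<in> carrier A" using y \<open>x \<in> carrier A\<close> Q.a_elemrcos_carrier by blast
      have "y \<ominus>\<^bsub>A\<^esub> x \<in> I" using y Q.a_rcos_module[OF \<open>x \<in> carrier A\<close> yc] by (simp add: A.minus_eq)
      then have "c \<odot>\<^bsub>A\<^esub> (y \<ominus>\<^bsub>A\<^esub> x) \<in> I" using I.smult_closed[of c] by simp
      then show ?thesis using eq[of "c \<odot>\<^bsub>A\<^esub> y" "c \<odot>\<^bsub>A\<^esub> x"] yc that \<open>x \<in> carrier A\<close>
        by (simp add: A.minus_eq A.smult_r_distr A.smult_r_minus)
    qed
    moreover have "x \<in> I +>\<^bsub>A\<^esub> x" using Q.a_rcos_self that by blast
    ultimately have "(\<Union>y\<in>I +>\<^bsub>A\<^esub> x. I +>\<^bsub>A\<^esub> (c \<odot>\<^bsub>A\<^esub> y)) = I +>\<^bsub>A\<^esub> (c \<odot>\<^bsub>A\<^esub> x)"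
      by (intro UN_constant_eq) blast+
    then show ?thesis by (simp add: quotient_nalg_def)
  qed
  have add: "(I +>\<^bsub>A\<^esub> x) \<oplus>\<^bsub>?Q\<^esub> (I +>\<^bsub>A\<^esub> y) = I +>\<^bsub>A\<^esub> (x \<oplus>\<^bsub>A\<^esub> y)" if "x \<in> carrier A" "y \<in> carrier A" for x y
    using Q.a_rcos_sum[OF that] by (simp add: quotient_nalg_def)
  have zero: "\<zero>\<^bsub>?Q\<^esub> = I +>\<^bsub>A\<^esub> \<zero>\<^bsub>A\<^esub>" using A.a_coset_add_zero[OF I.subset] by (simp add: quotient_nalg_def)
  have carr: "carrier ?Q = (\<lambda>x. I +>\<^bsub>A\<^esub> x) ` carrier A" by (auto simp: quotient_nalg_def A_RCOSETS_def')
  have "abelian_group ?Q"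
  proof (rule abelian_groupI)
    fix C assume "C \<in> carrier ?Q"
    then obtain x where x: "x \<in> carrier A" "C = I +>\<^bsub>A\<^esub> x" by (auto simp: carr)
    then show "\<exists>D\<in>carrier ?Q. D \<oplus>\<^bsub>?Q\<^esub> C = \<zero>\<^bsub>?Q\<^esub>"
      by (intro bexI[of _ "I +>\<^bsub>A\<^esub> (\<ominus>\<^bsub>A\<^esub> x)"]) (simp_all add: add zero carr A.l_neg)
  qed (auto simp: carr add zero A.a_assoc A.a_comm A.a_lcomm)
  then have "Module.module class_ring ?Q"
    using A.smult_l_distr A.smult_r_distr A.smult_assoc1 A.smult_one A.smult_closed
    by (intro Module.module.intro Module.module_axioms.intro class_cring.is_cring) (auto simp: carr add smu)
  then show "vectorspace class_ring ?Q" by (simp add: vectorspace_def class_field)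
qed

lemma nmult_single [simp]: "nmult (Poly_Mapping.single \<mu> a) (Poly_Mapping.single \<nu> b) = Poly_Mapping.single (App \<mu> \<nu>) (a * b)"
  by (auto simp: nmult_def)

lemma keys_nmult: "Poly_Mapping.keys (nmult f g) \<subseteq> {App \<mu> \<nu> | \<mu> \<nu>. \<mu> \<in> Poly_Mapping.keys f \<and> \<nu> \<in> Poly_Mapping.keys g}"
proof
  fix t assume "t \<in> Poly_Mapping.keys (nmult f g)"
  then have "(\<Sum>\<mu>\<in>Poly_Mapping.keys f. \<Sum>\<nu>\<in>Poly_Mapping.keys g. Poly_Mapping.lookup (Poly_Mapping.single (App \<mu> \<nu>) (Poly_Mapping.lookup f \<mu> * Poly_Mapping.lookup g \<nu>)) t) \<noteq> 0"
    by (simp add: nmult_def in_keys_iff lookup_sum)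
  then obtain \<mu> \<nu> where "\<mu> \<in> Poly_Mapping.keys f" "\<nu> \<in> Poly_Mapping.keys g" "Poly_Mapping.lookup (Poly_Mapping.single (App \<mu> \<nu>) (Poly_Mapping.lookup f \<mu> * Poly_Mapping.lookup g \<nu>)) t \<noteq> 0"
    by (meson sum.neutral)
  then show "t \<in> {App \<mu> \<nu> | \<mu> \<nu>. \<mu> \<in> Poly_Mapping.keys f \<and> \<nu> \<in> Poly_Mapping.keys g}"
    by (auto simp: lookup_single when_def split: if_splits)
qed

lemma rels_carrier: "(leibniz_rels X0 X1 :: ('k::field, 'x) nalg set) \<subseteq> carrier (free_nalg (X0 \<union> X1))"
proof
  fix s assume "s \<in> (leibniz_rels X0 X1 :: ('k::field, 'x) nalg set)"
  then obtain \<mu> \<nu> \<tau> where m: "\<mu> \<in> nterms (X0 \<union> X1)" "\<nu> \<in> nterms (X0 \<union> X1)" "\<tau> \<in> nterms (X0 \<union> X1)"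
    and s: "s = Poly_Mapping.single (App \<mu> (App \<nu> \<tau>)) 1
        - Poly_Mapping.single (App (App \<mu> \<nu>) \<tau>) 1
        + Poly_Mapping.single (App (App \<mu> \<tau>) \<nu>) ((-1) ^ (parity X1 \<nu> * parity X1 \<tau>))"
    unfolding leibniz_rels_def by blast
  show "s \<in> carrier (free_nalg (X0 \<union> X1))"
  proof -
    have "Poly_Mapping.keys s \<subseteq> {App \<mu> (App \<nu> \<tau>), App (App \<mu> \<nu>) \<tau>, App (App \<mu> \<tau>) \<nu>}"
      unfolding s by (auto simp: in_keys_iff lookup_add lookup_minus lookup_single when_def split: if_splits)
    also have "\<dots> \<subseteq> nterms (X0 \<union> X1)" using m by (simp add: nterms_def)
    finally show ?thesis by (simp add: free_nalg_def)
  qed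
qed

lemma leibniz_ideal: "two_sided_ideal (free_nalg (X0 \<union> X1)) (leibniz_ideal X0 X1 :: ('k::field, 'x) nalg set)"
proof -
  let ?A = "free_nalg (X0 \<union> X1) :: ('k, ('k, 'x) nalg) module"
  let ?F = "{t. two_sided_ideal ?A t \<and> leibniz_rels X0 X1 \<subseteq> t}"
  interpret A: vectorspace class_ring ?A by (rule vectorspace_free_nalg)
  have mc: "x \<otimes>\<^bsub>?A\<^esub> y \<in> carrier ?A" if "x \<in> carrier ?A" "y \<in> carrier ?A" for x y
    using that keys_nmult[of x y] by (fastforce simp: free_nalg_def nterms_def)
  have top: "carrier ?A \<in> ?F"
    using rels_carrier mc
    by (auto simp: two_sided_ideal_def subspace_def A.vectorspace_axioms LinearCombinations.submodule_def A.module_axioms)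
  have "two_sided_ideal ?A (\<Inter>?F)"
  proof (subst two_sided_ideal_def, intro conjI subspace.intro ballI LinearCombinations.submodule.intro A.vectorspace_axioms A.module_axioms)
    show "\<Inter>?F \<subseteq> carrier ?A" using top by blast
  qed (auto simp: two_sided_ideal_def subspace_def LinearCombinations.submodule_def)
  then show ?thesis by (simp add: leibniz_ideal_def generated_ideal_def hull_def)
qed

lemma vectorspace_Lbs: "vectorspace class_ring (Lbs X0 X1 :: ('k::field, ('k, 'x) nalg set) module)"
  unfolding Lbs_def using leibniz_ideal by (intro vectorspace_quotient(1)) (auto simp: two_sided_ideal_def)

end

theory Submission
  imports Defs
begin

text \<open>Let a letter act on \<open>kX\<^sup>*\<^sup>*\<close> by right multiplication and a product \<open>(\<mu>\<nu>)\<close> by the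
  supercommutator of the actions of \<open>\<mu>\<close> and \<open>\<nu>\<close>. Sending \<open>(\<mu>\<nu>)\<close> to the image of the normal form of
  \<open>\<mu>\<close> under the action of \<open>\<nu>\<close> gives a linear map \<open>N\<close> onto the span of the left-normed words. It kills
  the ideal by the super Jacobi identity and fixes left-normed words, whence linear independence.
  Conversely \<open>t - N(t)\<close> is a combination of elements \<open>\<sigma>\<^sub>\<star>\<^sub>\<mapsto>\<^sub>s\<close> with leading terms at most \<open>t\<close>, whence
  spanning. The Groebner-Shirshov property needs no case analysis of the inclusions: a composition
  \<open>h\<close> involves only terms below the overlap and \<open>N(h) = 0\<close>, so \<open>h\<close> is the combination of the
  \<open>t - N(t)\<close> over its terms \<open>t\<close>.\<close>

text \<open>Makes spans and subspaces available on the whole type of polynomials, free of carriers;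
  \<open>subspace_free_nalg_iff\<close> links them to the record-based notions.\<close>

interpretation nalg: vector_space "nscale :: 'k::field \<Rightarrow> ('k, 'x) nalg \<Rightarrow> ('k, 'x) nalg"
  by unfold_locales (auto intro!: poly_mapping_eqI simp: lookup_add algebra_simps)

abbreviation nalg_hom :: "(('k::field, 'x) nalg \<Rightarrow> ('k, 'y) nalg) \<Rightarrow> bool" where
  "nalg_hom \<equiv> Modules.module_hom nscale nscale"

abbreviation nmono :: "'x nterm \<Rightarrow> ('k::field, 'x) nalg" where
  "nmono \<mu> \<equiv> Poly_Mapping.single \<mu> 1"

lemma nscale_single [simp]: "nscale c (Poly_Mapping.single \<mu> d) = Poly_Mapping.single \<mu> (c * d)"
  by (auto intro!: poly_mapping_eqI simp: lookup_single when_def)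

lemma nalg_homI:
  assumes "\<And>f g. L (f + g) = L f + L g" "\<And>c f. L (nscale c f) = nscale c (L f)"
  shows "nalg_hom L"
  using assms by (simp add: Modules.module_hom_def Modules.module_hom_axioms_def nalg.module_axioms)

section \<open>Linear extension\<close>

definition linext :: "('x nterm \<Rightarrow> ('k::field, 'y) nalg) \<Rightarrow> ('k, 'x) nalg \<Rightarrow> ('k, 'y) nalg" where
  "linext \<phi> f = (\<Sum>\<mu>\<in>Poly_Mapping.keys f. nscale (Poly_Mapping.lookup f \<mu>) (\<phi> \<mu>))"

text \<open>Cancellation can make the support of a sum smaller than the union of the supports, so
  additivity is proved by summing over a common finite superset.\<close>

lemma linext_superset:
  assumes "finite A" "Poly_Mapping.keys f \<subseteq> A"
  shows "linext \<phi> f = (\<Sum>\<mu>\<in>A. nscale (Poly_Mapping.lookup f \<mu>) (\<phi> \<mu>))"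
  unfolding linext_def using assms by (intro sum.mono_neutral_left) (auto simp: in_keys_iff)

lemma nalg_hom_linext: "nalg_hom (linext \<phi>)"
proof (rule nalg_homI)
  fix f g :: "('a, 'b) nalg"
  let ?A = "Poly_Mapping.keys f \<union> Poly_Mapping.keys g"
  have "linext \<phi> (f + g) = (\<Sum>\<mu>\<in>?A. nscale (Poly_Mapping.lookup (f + g) \<mu>) (\<phi> \<mu>))"
    by (intro linext_superset) (auto simp: Poly_Mapping.keys_add)
  also have "\<dots> = linext \<phi> f + linext \<phi> g"
    by (simp add: linext_superset[of ?A] lookup_add nalg.scale_left_distrib sum.distrib)
  finally show "linext \<phi> (f + g) = linext \<phi> f + linext \<phi> g" .
next
  fix c and f :: "('a, 'b) nalg"
  have "linext \<phi> (nscale c f) = (\<Sum>\<mu>\<in>Poly_Mapping.keys f. nscale (Poly_Mapping.lookup (nscale c f) \<mu>) (\<phi> \<mu>))"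
    by (intro linext_superset) (auto simp: in_keys_iff)
  then show "linext \<phi> (nscale c f) = nscale c (linext \<phi> f)"
    by (simp add: linext_def nalg.scale_sum_right)
qed

lemmas linext_add = module_hom.add[OF nalg_hom_linext]
  and linext_diff = module_hom.diff[OF nalg_hom_linext]
  and linext_scale = module_hom.scale[OF nalg_hom_linext]
  and linext_zero [simp] = module_hom.zero[OF nalg_hom_linext]

lemma linext_single [simp]: "linext \<phi> (Poly_Mapping.single \<mu> c) = nscale c (\<phi> \<mu>)"
  by (auto simp: linext_def)

lemma linext_zero_fun [simp]: "linext (\<lambda>_. 0) f = 0"
  by (simp add: linext_def)

lemma linext_diff_fun: "linext (\<lambda>\<mu>. \<phi> \<mu> - \<psi> \<mu>) f = linext \<phi> f - linext \<psi> f"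
  by (simp add: linext_def nalg.scale_right_diff_distrib sum_subtractf)

lemma linext_scale_fun: "linext (\<lambda>\<mu>. nscale c (\<phi> \<mu>)) f = nscale c (linext \<phi> f)"
  by (simp add: linext_def nalg.scale_sum_right mult.commute)

lemma linext_hom: "nalg_hom L \<Longrightarrow> linext (\<lambda>\<mu>. L (\<phi> \<mu>)) f = L (linext \<phi> f)"
  by (simp add: linext_def module_hom.sum module_hom.scale)

lemma linext_nmono: "linext nmono f = f"
  by (rule poly_mapping_eqI)
    (auto simp: linext_def lookup_sum lookup_single when_def in_keys_iff)

lemma linext_swap: "linext (\<lambda>\<mu>. linext (\<lambda>\<nu>. F \<mu> \<nu>) g) f = linext (\<lambda>\<nu>. linext (\<lambda>\<mu>. F \<mu> \<nu>) f) g"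
proof -
  have "linext (\<lambda>\<mu>. linext (\<lambda>\<nu>. F \<mu> \<nu>) g) f = (\<Sum>\<mu>\<in>Poly_Mapping.keys f. \<Sum>\<nu>\<in>Poly_Mapping.keys g.
      nscale (Poly_Mapping.lookup f \<mu> * Poly_Mapping.lookup g \<nu>) (F \<mu> \<nu>))"
    by (simp add: linext_def nalg.scale_sum_right)
  also have "\<dots> = linext (\<lambda>\<nu>. linext (\<lambda>\<mu>. F \<mu> \<nu>) f) g"
    by (subst sum.swap) (simp add: linext_def nalg.scale_sum_right mult.commute)
  finally show ?thesis .
qed

lemma nmult_linext: "nmult f g = linext (\<lambda>\<mu>. linext (\<lambda>\<nu>. nmono (App \<mu> \<nu>)) g) f"
  by (simp add: nmult_def linext_def nalg.scale_sum_right)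

lemma linext_nmult: "linext \<phi> (nmult f g) = linext (\<lambda>\<mu>. linext (\<lambda>\<nu>. \<phi> (App \<mu> \<nu>)) g) f"
  by (simp add: nmult_linext flip: linext_hom[OF nalg_hom_linext])

lemma nalg_hom_nmult_left: "nalg_hom (\<lambda>f. nmult f g)"
  unfolding nmult_linext by (rule nalg_hom_linext)

text \<open>A word is a product in only one way, so at most one pair of words contributes to each
  coefficient.\<close>

lemma lookup_nmult_App:
  "Poly_Mapping.lookup (nmult f g) (App \<mu> \<nu>) = Poly_Mapping.lookup f \<mu> * Poly_Mapping.lookup g \<nu>"
proof -
  have "Poly_Mapping.lookup (nmult f g) (App \<mu> \<nu>) =
      (\<Sum>\<mu>'\<in>Poly_Mapping.keys f. \<Sum>\<nu>'\<in>Poly_Mapping.keys g.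
        if \<mu>' = \<mu> then if \<nu>' = \<nu> then Poly_Mapping.lookup f \<mu> * Poly_Mapping.lookup g \<nu> else 0 else 0)"
    by (auto simp: nmult_def lookup_sum lookup_single when_def intro!: sum.cong)
  also have "\<dots> = (\<Sum>\<mu>'\<in>Poly_Mapping.keys f. if \<mu>' = \<mu> then \<Sum>\<nu>'\<in>Poly_Mapping.keys g.
        if \<nu>' = \<nu> then Poly_Mapping.lookup f \<mu> * Poly_Mapping.lookup g \<nu> else 0 else 0)"
    by (intro sum.cong) auto
  also have "\<dots> = Poly_Mapping.lookup f \<mu> * Poly_Mapping.lookup g \<nu>"
    by (simp add: in_keys_iff)
  finally show ?thesis .
qed

lemma linext_in_subspace:
  assumes "nalg.subspace V" "\<And>\<mu>. \<mu> \<in> Poly_Mapping.keys f \<Longrightarrow> \<phi> \<mu> \<in> V"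
  shows "linext \<phi> f \<in> V"
  unfolding linext_def using assms by (intro nalg.subspace_sum nalg.subspace_scale)

section \<open>Normal forms\<close>

text \<open>The Leibniz identity solved for x(yz): multiplying on the right by a product is traded
  for successive actions of its two factors, until only multiplications by letters are left.\<close>

primrec right_action :: "'x set \<Rightarrow> 'x nterm \<Rightarrow> ('k::field, 'x) nalg \<Rightarrow> ('k, 'x) nalg" where
  "right_action X1 (Letter a) f = nmult f (nmono (Letter a))"
| "right_action X1 (App \<mu> \<nu>) f = right_action X1 \<nu> (right_action X1 \<mu> f)
     - nscale ((-1) ^ (parity X1 \<mu> * parity X1 \<nu>)) (right_action X1 \<mu> (right_action X1 \<nu> f))"

primrec normal_form :: "'x set \<Rightarrow> 'x nterm \<Rightarrow> ('k::field, 'x) nalg" where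
  "normal_form X1 (Letter a) = nmono (Letter a)"
| "normal_form X1 (App \<mu> \<nu>) = right_action X1 \<nu> (normal_form X1 \<mu>)"

lemma nalg_hom_right_action: "nalg_hom (right_action X1 \<mu>)"
proof (induction \<mu>)
  case (Letter a)
  show ?case
    by (intro nalg_homI)
      (simp_all add: module_hom.add[OF nalg_hom_nmult_left] module_hom.scale[OF nalg_hom_nmult_left])
next
  case (App \<mu> \<nu>)
  then show ?case
    by (intro nalg_homI)
      (simp_all add: module_hom.add module_hom.scale nalg.scale_right_distrib
        nalg.scale_right_diff_distrib nalg.scale_left_commute)
qed

lemmas right_action_diff = module_hom.diff[OF nalg_hom_right_action]
  and right_action_zero [simp] = module_hom.zero[OF nalg_hom_right_action]
  and right_action_add = module_hom.add[OF nalg_hom_right_action]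

section \<open>Parity components and the kernel of the normal form map\<close>

lemma parity_cases: "parity X1 \<mu> = 0 \<or> parity X1 \<mu> = 1"
  by (cases \<mu>) auto

text \<open>The homogeneous component of \<open>f\<close> of parity \<open>p\<close> acting on
  \<open>x\<close>; it is zero for \<open>p\<close> other than 0 and 1.\<close>

definition parity_action :: "'x set \<Rightarrow> nat \<Rightarrow> ('k::field, 'x) nalg \<Rightarrow> ('k, 'x) nalg \<Rightarrow> ('k, 'x) nalg" where
  "parity_action X1 p x f = linext (\<lambda>\<mu>. if parity X1 \<mu> = p then right_action X1 \<mu> x else 0) f"

text \<open>The two parity components of the action must vanish separately for this to be an ideal,
  because the sign in the supercommutator depends on the parity.\<close>

definition nf_kernel :: "'x set \<Rightarrow> ('k::field, 'x) nalg set" where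
  "nf_kernel X1 = {f. linext (normal_form X1) f = 0 \<and> (\<forall>p x. parity_action X1 p x f = 0)}"

lemma linext_right_action_kernel:
  assumes "f \<in> nf_kernel X1"
  shows "linext (\<lambda>\<mu>. right_action X1 \<mu> x) f = 0"
proof -
  \<comment> \<open>Every word has parity 0 or 1, so the two components add up to the full action.
    The sum is phrased as a difference so that \<open>linext_diff_fun\<close> applies.\<close>
  have "linext (\<lambda>\<mu>. right_action X1 \<mu> x) f = parity_action X1 0 x f - nscale (-1) (parity_action X1 1 x f)"
    unfolding parity_action_def linext_scale_fun[symmetric] linext_diff_fun[symmetric]
  proof (intro arg_cong[where f = "\<lambda>\<phi>. linext \<phi> f"] ext)
    show "right_action X1 \<mu> x = (if parity X1 \<mu> = 0 then right_action X1 \<mu> x else 0)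
        - nscale (-1) (if parity X1 \<mu> = 1 then right_action X1 \<mu> x else 0)" for \<mu>
      using parity_cases[of X1 \<mu>] by auto
  qed
  then show ?thesis using assms by (simp add: nf_kernel_def)
qed

text \<open>The parities of a product and of one factor determine that of the other. The sign in the
  supercommutator thus becomes a constant that can be pulled out of a linear extension.\<close>

lemma parity_App_iff:
  assumes "p < 2"
  shows "parity X1 (App \<mu> \<nu>) = p \<longleftrightarrow> parity X1 \<nu> = (p + parity X1 \<mu>) mod 2"
    "parity X1 (App \<mu> \<nu>) = p \<longleftrightarrow> parity X1 \<mu> = (p + parity X1 \<nu>) mod 2"
  using assms parity_cases[of X1 \<mu>] parity_cases[of X1 \<nu>] by (auto simp: less_2_cases_iff)

lemma parity_action_ge2: "2 \<le> p \<Longrightarrow> parity_action X1 p x f = 0"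
proof -
  assume "2 \<le> p"
  then have "parity X1 \<mu> \<noteq> p" for \<mu> using parity_cases[of X1 \<mu>] by auto
  then show ?thesis by (simp add: parity_action_def)
qed

text \<open>Expand in the words \<open>\<mu>\<close> of \<open>g\<close>. In each parity only one
  component of \<open>f\<close> enters, and it acts as zero both on \<open>x\<close> and on the
  image of \<open>x\<close> under \<open>\<mu>\<close>.\<close>

lemma nf_kernel_mult_left:
  assumes f: "f \<in> nf_kernel X1"
  shows "nmult g f \<in> nf_kernel X1"
proof -
  have "parity_action X1 p x (nmult g f) = 0" for p x
  proof (cases "p < 2")
    case True
    have "linext (\<lambda>\<nu>. if parity X1 (App \<mu> \<nu>) = p then right_action X1 (App \<mu> \<nu>) x else 0) f = 0" for \<mu>
    proof -
      define r where "r = (p + parity X1 \<mu>) mod 2"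
      have "linext (\<lambda>\<nu>. if parity X1 (App \<mu> \<nu>) = p then right_action X1 (App \<mu> \<nu>) x else 0) f =
        linext (\<lambda>\<nu>. (if parity X1 \<nu> = r then right_action X1 \<nu> (right_action X1 \<mu> x) else 0) -
           nscale ((-1) ^ (parity X1 \<mu> * r)) (right_action X1 \<mu> (if parity X1 \<nu> = r then right_action X1 \<nu> x else 0))) f"
        unfolding parity_App_iff(1)[OF True] r_def[symmetric]
        by (intro arg_cong[where f = "\<lambda>\<phi>. linext \<phi> f"] ext) simp
      also have "\<dots> = parity_action X1 r (right_action X1 \<mu> x) f
          - nscale ((-1) ^ (parity X1 \<mu> * r)) (right_action X1 \<mu> (parity_action X1 r x f))"
        by (simp add: linext_diff_fun linext_scale_fun linext_hom[OF nalg_hom_right_action] parity_action_def)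
      finally show ?thesis using f by (simp add: nf_kernel_def)
    qed
    then show ?thesis by (simp add: parity_action_def linext_nmult)
  qed (simp add: parity_action_ge2)
  \<comment> \<open>The right factor acts on the normal form of the left one, so what is used here
    is that the action of \<open>f\<close> vanishes, not that its normal form does.\<close>
  moreover have "linext (normal_form X1) (nmult g f) = 0"
    by (simp add: linext_nmult linext_right_action_kernel[OF f])
  ultimately show ?thesis by (simp add: nf_kernel_def)
qed

text \<open>\<open>linext_swap\<close> moves the sum over the words of \<open>f\<close> inside. For
  a fixed word \<open>\<nu>\<close> of \<open>g\<close> the action of \<open>\<nu>\<close> is
  linear, so it can be pulled out and is applied to zero.\<close>

lemma nf_kernel_mult_right:
  assumes f: "f \<in> nf_kernel X1"
  shows "nmult f g \<in> nf_kernel X1"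
proof -
  have "parity_action X1 p x (nmult f g) = 0" for p x
  proof (cases "p < 2")
    case True
    have "linext (\<lambda>\<mu>. if parity X1 (App \<mu> \<nu>) = p then right_action X1 (App \<mu> \<nu>) x else 0) f = 0" for \<nu>
    proof -
      define r where "r = (p + parity X1 \<nu>) mod 2"
      have "linext (\<lambda>\<mu>. if parity X1 (App \<mu> \<nu>) = p then right_action X1 (App \<mu> \<nu>) x else 0) f =
        linext (\<lambda>\<mu>. right_action X1 \<nu> (if parity X1 \<mu> = r then right_action X1 \<mu> x else 0) -
           nscale ((-1) ^ (r * parity X1 \<nu>)) (if parity X1 \<mu> = r then right_action X1 \<mu> (right_action X1 \<nu> x) else 0)) f"
        unfolding parity_App_iff(2)[OF True] r_def[symmetric]
        by (intro arg_cong[where f = "\<lambda>\<phi>. linext \<phi> f"] ext) simp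
      also have "\<dots> = right_action X1 \<nu> (parity_action X1 r x f)
          - nscale ((-1) ^ (r * parity X1 \<nu>)) (parity_action X1 r (right_action X1 \<nu> x) f)"
        by (simp add: linext_diff_fun linext_scale_fun linext_hom[OF nalg_hom_right_action] parity_action_def)
      finally show ?thesis using f by (simp add: nf_kernel_def)
    qed
    then show ?thesis unfolding parity_action_def linext_nmult by (subst linext_swap) simp
  qed (simp add: parity_action_ge2)
  moreover have "linext (normal_form X1) (nmult f g) = 0"
    using f unfolding linext_nmult
    by (subst linext_swap) (simp add: linext_hom[OF nalg_hom_right_action] nf_kernel_def)
  ultimately show ?thesis by (simp add: nf_kernel_def)
qed

definition leibniz_rel :: "'x set \<Rightarrow> 'x nterm \<Rightarrow> 'x nterm \<Rightarrow> 'x nterm \<Rightarrow> ('k::field, 'x) nalg" where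
  "leibniz_rel X1 \<mu> \<nu> \<tau> = nmono (App \<mu> (App \<nu> \<tau>)) - nmono (App (App \<mu> \<nu>) \<tau>)
     + Poly_Mapping.single (App (App \<mu> \<tau>) \<nu>) ((-1) ^ (parity X1 \<nu> * parity X1 \<tau>))"

lemma leibniz_rels_eq: "leibniz_rels X0 X1 = {leibniz_rel X1 \<mu> \<nu> \<tau> | \<mu> \<nu> \<tau>.
    \<mu> \<in> nterms (X0 \<union> X1) \<and> \<nu> \<in> nterms (X0 \<union> X1) \<and> \<tau> \<in> nterms (X0 \<union> X1)}"
  by (simp add: leibniz_rels_def leibniz_rel_def)

text \<open>The right action turns products into supercommutators, so this is the super Jacobi identity.\<close>

lemma leibniz_rel_in_kernel: "(leibniz_rel X1 \<mu> \<nu> \<tau> :: ('k::field, 'x) nalg) \<in> nf_kernel X1"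
proof -
  \<comment> \<open>On normal forms the relation is just the definition of the action of
    \<open>App \<nu> \<tau>\<close>, evaluated at the normal form of \<open>\<mu>\<close>.\<close>
  have "linext (normal_form X1) (leibniz_rel X1 \<mu> \<nu> \<tau> :: ('k, 'x) nalg) = 0"
    by (simp add: leibniz_rel_def linext_add linext_diff)
  moreover have "parity_action X1 p x (leibniz_rel X1 \<mu> \<nu> \<tau> :: ('k, 'x) nalg) = 0" for p x
  proof -
    \<comment> \<open>The three words of the relation have the same parity, so a parity component
      picks out all of them or none.\<close>
    have par: "parity X1 (App (App \<mu> \<nu>) \<tau>) = parity X1 (App \<mu> (App \<nu> \<tau>))"
      "parity X1 (App (App \<mu> \<tau>) \<nu>) = parity X1 (App \<mu> (App \<nu> \<tau>))"
      by (simp_all add: mod_simps ac_simps)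
    \<comment> \<open>Fixing the three parities makes every sign explicit; the threefold composites
      then cancel by linearity.\<close>
    have "right_action X1 (App \<mu> (App \<nu> \<tau>)) x - right_action X1 (App (App \<mu> \<nu>) \<tau>) x
      + nscale ((-1) ^ (parity X1 \<nu> * parity X1 \<tau>)) (right_action X1 (App (App \<mu> \<tau>) \<nu>) x) = 0"
      using parity_cases[of X1 \<mu>] parity_cases[of X1 \<nu>] parity_cases[of X1 \<tau>]
      by (elim disjE) (simp_all add: right_action_diff right_action_add)
    then show ?thesis
      unfolding parity_action_def leibniz_rel_def linext_add linext_diff linext_single par
      by (cases "parity X1 (App \<mu> (App \<nu> \<tau>)) = p") (simp_all only: if_True if_False simp_thms nalg.scale_one nalg.scale_zero_right diff_self add_0)
  qed
  ultimately show ?thesis by (simp add: nf_kernel_def)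
qed

lemma subspace_nf_kernel: "nalg.subspace (nf_kernel X1)"
  by (auto simp: nalg.subspace_def nf_kernel_def parity_action_def linext_add linext_scale)

section \<open>Leading terms\<close>

abbreviation nle :: "'x::wellorder nterm \<Rightarrow> 'x nterm \<Rightarrow> bool" where
  "nle \<mu> \<nu> \<equiv> nless \<mu> \<nu> \<or> \<mu> = \<nu>"

lemma nle_trans: "nle \<mu> \<nu> \<Longrightarrow> nle \<nu> \<tau> \<Longrightarrow> nle \<mu> \<tau>"
  using nless_trans by blast

lemma nless_App_mono:
  assumes "nle \<mu> \<mu>'" "nle \<nu> \<nu>'" "\<mu> \<noteq> \<mu>' \<or> \<nu> \<noteq> \<nu>'"
  shows "nless (App \<mu> \<nu>) (App \<mu>' \<nu>')"
  using assms nless_len[of \<mu> \<mu>'] nless_len[of \<nu> \<nu>'] by (auto simp: nless_App')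

lemma nle_App_left: "nle \<mu> \<mu>' \<Longrightarrow> nle (App \<mu> \<nu>) (App \<mu>' \<nu>)"
  using nless_App_mono by blast

text \<open>At equal length the right factors are compared first, and these by length. This is what
  makes the right-nested word the leading term of a Leibniz relation.\<close>

lemma nless_rotate:
  assumes "len \<mu> + len \<nu> = len \<mu>' + len \<nu>'" "len \<nu> < len \<nu>'"
  shows "nless (App \<mu> \<nu>) (App \<mu>' \<nu>')"
  using assms nless.length[of \<nu> \<nu>'] by (simp add: nless_App')

text \<open>A relational substitute for the definite description in \<open>leading_term\<close>: it
  passes to products directly, and \<open>leading_term_eq\<close> converts back.\<close>

definition monic_lead :: "('k::field, 'x::wellorder) nalg \<Rightarrow> 'x nterm \<Rightarrow> bool" where
  "monic_lead f \<mu> \<longleftrightarrow> Poly_Mapping.lookup f \<mu> = 1 \<and> (\<forall>\<nu>\<in>Poly_Mapping.keys f. nle \<nu> \<mu>)"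

lemma leading_term_eq: "monic_lead f \<mu> \<Longrightarrow> leading_term nless f = \<mu>"
  unfolding leading_term_def
proof (rule the_equality)
  assume "monic_lead f \<mu>"
  then show "\<mu> \<in> Poly_Mapping.keys f \<and> (\<forall>\<nu>\<in>Poly_Mapping.keys f. \<nu> \<noteq> \<mu> \<longrightarrow> nless \<nu> \<mu>)"
    by (auto simp: monic_lead_def in_keys_iff)
  fix \<tau> assume \<tau>: "\<tau> \<in> Poly_Mapping.keys f \<and> (\<forall>\<nu>\<in>Poly_Mapping.keys f. \<nu> \<noteq> \<tau> \<longrightarrow> nless \<nu> \<tau>)"
  have "\<mu> \<in> Poly_Mapping.keys f" "nle \<tau> \<mu>"
    using \<open>monic_lead f \<mu>\<close> \<tau> by (auto simp: monic_lead_def in_keys_iff)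
  then show "\<tau> = \<mu>" using \<tau> nless_trans[of \<mu> \<tau> \<mu>] nless_irrefl[of \<mu>] by auto
qed

text \<open>Unique factorization of words gives the leading coefficient, compatibility of the order
  with multiplication gives the bound on the other terms.\<close>

lemma monic_lead_nmult:
  assumes "monic_lead f \<mu>" "monic_lead g \<nu>"
  shows "monic_lead (nmult f g) (App \<mu> \<nu>)"
  unfolding monic_lead_def lookup_nmult_App
proof (intro conjI ballI)
  fix \<tau> assume "\<tau> \<in> Poly_Mapping.keys (nmult f g)"
  then obtain \<mu>' \<nu>' where "\<tau> = App \<mu>' \<nu>'" "\<mu>' \<in> Poly_Mapping.keys f" "\<nu>' \<in> Poly_Mapping.keys g"
    using keys_nmult[of f g] by blast
  moreover from this have "nle \<mu>' \<mu>" "nle \<nu>' \<nu>" using assms by (auto simp: monic_lead_def)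
  ultimately show "nle \<tau> (App \<mu> \<nu>)" using nless_App_mono[of \<mu>' \<mu> \<nu>' \<nu>] by blast
qed (use assms in \<open>simp add: monic_lead_def\<close>)

lemma monic_lead_nmono: "monic_lead (nmono \<mu>) \<mu>"
  by (simp add: monic_lead_def)

text \<open>Both \<open>\<nu>\<close> and \<open>\<tau>\<close> are shorter than their product, so
  the other two words lie strictly below. They cannot touch the leading coefficient, even if they
  coincide because \<open>\<nu> = \<tau>\<close>.\<close>

lemma monic_lead_leibniz_rel: "monic_lead (leibniz_rel X1 \<mu> \<nu> \<tau>) (App \<mu> (App \<nu> \<tau>))"
proof -
  have "nless (App (App \<mu> \<nu>) \<tau>) (App \<mu> (App \<nu> \<tau>))" "nless (App (App \<mu> \<tau>) \<nu>) (App \<mu> (App \<nu> \<tau>))"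
    using len_pos[of \<nu>] len_pos[of \<tau>] by (auto intro!: nless_rotate)
  then show ?thesis
    using nless_irrefl[of "App \<mu> (App \<nu> \<tau>)"]
    unfolding monic_lead_def leibniz_rel_def
    by (auto simp: in_keys_iff lookup_add lookup_minus lookup_single when_def split: if_splits)
qed

lemma leibniz_rels_monic_lead: "s \<in> leibniz_rels X0 X1 \<Longrightarrow> \<exists>\<mu>. monic_lead s \<mu>"
  unfolding leibniz_rels_eq using monic_lead_leibniz_rel by blast

section \<open>Substitution into star terms\<close>

lemma monic_lead_star_subst:
  assumes "monic_lead f \<mu>"
  shows "\<exists>\<nu>. monic_lead (star_subst \<sigma> f) \<nu>"
proof (induction \<sigma>)
  case (Letter z)
  then show ?case using assms monic_lead_nmono by (cases z) auto
next
  case (App \<sigma> \<rho>)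
  then show ?case using monic_lead_nmult by fastforce
qed

text \<open>If a product contains exactly one star, the factor with the star lands in
  \<open>I\<close> by induction and the star-free factor in \<open>A\<close>. The lemma is applied
  with \<open>I\<close> the kernel, the carrier and the Leibniz ideal.\<close>

lemma star_subst_in_ideal:
  assumes "\<And>g h. g \<in> A \<Longrightarrow> h \<in> I \<Longrightarrow> nmult g h \<in> I \<and> nmult h g \<in> I"
    and "\<And>g h. g \<in> A \<Longrightarrow> h \<in> A \<Longrightarrow> nmult g h \<in> A"
    and "\<And>a. a \<in> X \<Longrightarrow> nmono (Letter a) \<in> A"
    and "f \<in> I" "\<sigma> \<in> star_terms X"
  shows "star_subst \<sigma> f \<in> I"
proof -
  have A: "star_subst \<rho> f \<in> A" if "set_nterm \<rho> \<subseteq> insert None (Some ` X)" "occurrences \<rho> None = 0" for \<rho>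
    using that by (induction \<rho>) (use assms in \<open>auto split: option.split\<close>)
  have "star_subst \<sigma> f \<in> I" if "set_nterm \<sigma> \<subseteq> insert None (Some ` X)" "occurrences \<sigma> None = 1"
    using that
  proof (induction \<sigma>)
    case (Letter z)
    then show ?case using assms by (auto split: if_splits)
  next
    case (App \<sigma> \<rho>)
    then consider "occurrences \<sigma> None = 1" "occurrences \<rho> None = 0"
      | "occurrences \<sigma> None = 0" "occurrences \<rho> None = 1" by fastforce
    then show ?case using App A[of \<sigma>] A[of \<rho>] assms(1) by cases auto
  qed
  then show ?thesis using assms(5) by (simp add: star_terms_def nterms_def)
qed

lemma star_subst_in_kernel: "f \<in> nf_kernel X1 \<Longrightarrow> \<sigma> \<in> star_terms X \<Longrightarrow> star_subst \<sigma> f \<in> nf_kernel X1"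
  by (rule star_subst_in_ideal[where A = UNIV]) (auto simp: nf_kernel_mult_left nf_kernel_mult_right)

section \<open>Reduction to normal form\<close>

text \<open>The bound is weak because reducing \<open>\<mu>\<close> may start with a relation whose
  leading term is \<open>\<mu>\<close> itself. Strictness in the Groebner-Shirshov condition comes
  from the terms of a composition lying below the overlap.\<close>

definition combs_upto :: "'x::wellorder set \<Rightarrow> ('k::field, 'x) nalg set \<Rightarrow> 'x nterm \<Rightarrow> ('k, 'x) nalg set" where
  "combs_upto X S \<mu> = nalg.span {star_subst \<sigma> s | \<sigma> s.
     \<sigma> \<in> star_terms X \<and> s \<in> S \<and> nle (leading_term nless (star_subst \<sigma> s)) \<mu>}"

lemma subspace_combs_upto: "nalg.subspace (combs_upto X S \<mu>)"
  by (simp add: combs_upto_def)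

lemma combs_upto_mono: "nle \<mu> \<nu> \<Longrightarrow> combs_upto X S \<mu> \<subseteq> combs_upto X S \<nu>"
  unfolding combs_upto_def by (intro nalg.span_mono) (auto dest: nle_trans intro: nless_trans)

lemma star_subst_map_Some: "star_subst (map_nterm Some \<mu>) f = nmono \<mu>"
  by (induction \<mu>) auto

lemma occurrences_map_Some: "occurrences (map_nterm Some \<mu>) None = 0"
  by (induction \<mu>) auto

lemma combs_upto_mult_right:
  assumes S: "\<And>s. s \<in> S \<Longrightarrow> \<exists>\<mu>. monic_lead s \<mu>"
    and f: "f \<in> combs_upto X S \<mu>" and \<nu>: "\<nu> \<in> nterms X"
  shows "nmult f (nmono \<nu>) \<in> combs_upto X S (App \<mu> \<nu>)"
proof -
  \<comment> \<open>Right multiplication by \<open>\<nu>\<close> is linear, so the preimage is a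
    subspace and only the generators have to be checked.\<close>
  have "combs_upto X S \<mu> \<subseteq> (\<lambda>f. nmult f (nmono \<nu>)) -` combs_upto X S (App \<mu> \<nu>)"
    unfolding combs_upto_def[of _ _ \<mu>]
  proof (intro nalg.span_minimal)
    show "nalg.subspace ((\<lambda>f. nmult f (nmono \<nu>)) -` combs_upto X S (App \<mu> \<nu>))"
      by (rule module_hom.subspace_vimage[OF nalg_hom_nmult_left subspace_combs_upto])
  next
    show "{star_subst \<sigma> s |\<sigma> s. \<sigma> \<in> star_terms X \<and> s \<in> S \<and> nle (leading_term nless (star_subst \<sigma> s)) \<mu>}
      \<subseteq> (\<lambda>f. nmult f (nmono \<nu>)) -` combs_upto X S (App \<mu> \<nu>)"
    proof clarify
      fix \<sigma> s assume \<sigma>: "\<sigma> \<in> star_terms X" "s \<in> S" and le: "nle (leading_term nless (star_subst \<sigma> s)) \<mu>"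
      obtain \<tau> where \<tau>: "monic_lead (star_subst \<sigma> s) \<tau>" using S[OF \<sigma>(2)] monic_lead_star_subst by blast
      \<comment> \<open>The product of a generator with \<open>\<nu>\<close> is again a generator:
        multiply the star term by \<open>\<nu>\<close>, viewed as a star-free term.\<close>
      let ?\<sigma> = "App \<sigma> (map_nterm Some \<nu>)"
      have eq: "star_subst ?\<sigma> s = nmult (star_subst \<sigma> s) (nmono \<nu>)" by (simp add: star_subst_map_Some)
      have "leading_term nless (star_subst ?\<sigma> s) = App \<tau> \<nu>"
        unfolding eq by (intro leading_term_eq monic_lead_nmult \<tau> monic_lead_nmono)
      moreover have "nle (App \<tau> \<nu>) (App \<mu> \<nu>)" using le by (simp only: leading_term_eq[OF \<tau>] nle_App_left)
      moreover have "?\<sigma> \<in> star_terms X"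
        using \<sigma>(1) \<nu> by (auto simp: star_terms_def nterms_def nterm.set_map occurrences_map_Some)
      ultimately have "star_subst ?\<sigma> s \<in> combs_upto X S (App \<mu> \<nu>)"
        unfolding combs_upto_def using \<sigma>(2) by (intro nalg.span_base) force
      then show "star_subst \<sigma> s \<in> (\<lambda>f. nmult f (nmono \<nu>)) -` combs_upto X S (App \<mu> \<nu>)"
        unfolding eq by simp
    qed
  qed
  then show ?thesis using f by blast
qed

section \<open>Order, length and letters of the terms of a normal form\<close>

lemma keys_diff_scale: "Poly_Mapping.keys (f - nscale c g) \<subseteq> Poly_Mapping.keys f \<union> Poly_Mapping.keys g"
  by (auto simp: in_keys_iff lookup_minus)

text \<open>Leibniz rewriting preserves length and letters. The length permits comparison after a
  further multiplication, and the letters keep the words over \<open>X\<close>.\<close>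

definition reduct_of :: "'x::wellorder nterm \<Rightarrow> 'x nterm \<Rightarrow> bool" where
  "reduct_of \<tau> \<mu> \<longleftrightarrow> nle \<tau> \<mu> \<and> len \<tau> = len \<mu> \<and> set_nterm \<tau> = set_nterm \<mu>"

lemma reduct_of_refl: "reduct_of \<mu> \<mu>"
  by (simp add: reduct_of_def)

lemma reduct_of_trans: "reduct_of \<mu> \<nu> \<Longrightarrow> reduct_of \<nu> \<tau> \<Longrightarrow> reduct_of \<mu> \<tau>"
  unfolding reduct_of_def using nle_trans[of \<mu> \<nu> \<tau>] by auto

lemma reduct_of_App_left: "reduct_of \<mu> \<mu>' \<Longrightarrow> reduct_of (App \<mu> \<nu>) (App \<mu>' \<nu>)"
  unfolding reduct_of_def using nle_App_left[of \<mu> \<mu>' \<nu>] by auto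

lemma reduct_of_rotate:
  "reduct_of (App (App \<mu> \<nu>) \<tau>) (App \<mu> (App \<nu> \<tau>))"
  "reduct_of (App (App \<mu> \<tau>) \<nu>) (App \<mu> (App \<nu> \<tau>))"
  using len_pos[of \<nu>] len_pos[of \<tau>] by (auto simp: reduct_of_def intro!: nless_rotate)

text \<open>By induction a double action yields reducts of
  \<open>App (App \<kappa> \<mu>) \<nu>\<close> or \<open>App (App \<kappa> \<nu>) \<mu>\<close>,
  and both of these are reducts of \<open>App \<kappa> (App \<mu> \<nu>)\<close>.\<close>

lemma keys_right_action:
  fixes f :: "('k::field, 'x::wellorder) nalg"
  assumes "\<tau> \<in> Poly_Mapping.keys (right_action X1 \<nu> f)"
  obtains \<mu> where "\<mu> \<in> Poly_Mapping.keys f" "reduct_of \<tau> (App \<mu> \<nu>)"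
proof -
  have "\<exists>\<mu>\<in>Poly_Mapping.keys f. reduct_of \<tau> (App \<mu> \<nu>)"
    using assms
  proof (induction \<nu> arbitrary: f \<tau>)
    case (Letter a)
    then have "\<tau> \<in> Poly_Mapping.keys (nmult f (nmono (Letter a)))" by simp
    then obtain \<mu> where "\<mu> \<in> Poly_Mapping.keys f" "\<tau> = App \<mu> (Letter a)"
      using keys_nmult[of f "nmono (Letter a)"] by auto
    then show ?case using reduct_of_refl by blast
  next
    case (App \<mu> \<nu>)
    from App.prems keys_diff_scale consider
      "\<tau> \<in> Poly_Mapping.keys (right_action X1 \<nu> (right_action X1 \<mu> f))" |
      "\<tau> \<in> Poly_Mapping.keys (right_action X1 \<mu> (right_action X1 \<nu> f))"
      unfolding right_action.simps by blast
    then show ?case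
    proof cases
      case 1
      from App.IH(2)[OF 1] obtain \<rho> where \<rho>: "\<rho> \<in> Poly_Mapping.keys (right_action X1 \<mu> f)"
        "reduct_of \<tau> (App \<rho> \<nu>)" by blast
      from App.IH(1)[OF \<rho>(1)] obtain \<kappa> where \<kappa>: "\<kappa> \<in> Poly_Mapping.keys f" "reduct_of \<rho> (App \<kappa> \<mu>)" by blast
      show ?thesis
        using \<kappa>(1) reduct_of_trans[OF reduct_of_trans[OF \<rho>(2) reduct_of_App_left[OF \<kappa>(2)]] reduct_of_rotate(1)]
        by blast
    next
      case 2
      from App.IH(1)[OF 2] obtain \<rho> where \<rho>: "\<rho> \<in> Poly_Mapping.keys (right_action X1 \<nu> f)"
        "reduct_of \<tau> (App \<rho> \<mu>)" by blast
      from App.IH(2)[OF \<rho>(1)] obtain \<kappa> where \<kappa>: "\<kappa> \<in> Poly_Mapping.keys f" "reduct_of \<rho> (App \<kappa> \<nu>)" by blast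
      show ?thesis
        using \<kappa>(1) reduct_of_trans[OF reduct_of_trans[OF \<rho>(2) reduct_of_App_left[OF \<kappa>(2)]] reduct_of_rotate(2)]
        by blast
    qed
  qed
  then show ?thesis using that by blast
qed

lemma keys_normal_form:
  "\<tau> \<in> Poly_Mapping.keys (normal_form X1 \<mu> :: ('k::field, 'x::wellorder) nalg) \<Longrightarrow> reduct_of \<tau> \<mu>"
proof (induction \<mu> arbitrary: \<tau>)
  case (Letter a)
  then show ?case by (simp add: reduct_of_refl)
next
  case (App \<mu> \<nu>)
  then have "\<tau> \<in> Poly_Mapping.keys (right_action X1 \<nu> (normal_form X1 \<mu> :: ('k, 'x) nalg))" by simp
  then obtain \<rho> where \<rho>: "\<rho> \<in> Poly_Mapping.keys (normal_form X1 \<mu> :: ('k, 'x) nalg)"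
    "reduct_of \<tau> (App \<rho> \<nu>)" by (rule keys_right_action)
  show ?case using reduct_of_trans[OF \<rho>(2) reduct_of_App_left[OF App.IH(1)[OF \<rho>(1)]]] .
qed

text \<open>Multiplication by \<open>\<nu>\<close> and the action of \<open>\<nu>\<close> are both
  linear, so comparing them on the words of \<open>f\<close> is enough.\<close>

lemma reduce_right_mult_keys:
  assumes "\<And>\<mu>. \<mu> \<in> Poly_Mapping.keys f \<Longrightarrow> nmono (App \<mu> \<nu>) - right_action X1 \<nu> (nmono \<mu>) \<in> V"
    and "nalg.subspace V"
  shows "nmult f (nmono \<nu>) - right_action X1 \<nu> f \<in> V"
proof -
  have "linext (\<lambda>\<mu>. nmono (App \<mu> \<nu>) - right_action X1 \<nu> (nmono \<mu>)) f = nmult f (nmono \<nu>) - right_action X1 \<nu> f"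
    by (simp add: linext_diff_fun linext_hom[OF nalg_hom_right_action] linext_nmono nmult_linext)
  moreover have "linext (\<lambda>\<mu>. nmono (App \<mu> \<nu>) - right_action X1 \<nu> (nmono \<mu>)) f \<in> V"
    using assms by (intro linext_in_subspace)
  ultimately show ?thesis by simp
qed

text \<open>Induction on the right factor. The relation with leading term
  \<open>App \<mu> (App \<alpha> \<beta>)\<close> replaces this word by two smaller ones whose right
  factors are \<open>\<beta>\<close> and \<open>\<alpha>\<close>, and these are covered by the
  induction hypotheses.\<close>

lemma reduce_right_mult:
  fixes X0 X1 :: "'x::wellorder set"
  assumes "\<mu> \<in> nterms (X0 \<union> X1)" "\<nu> \<in> nterms (X0 \<union> X1)"
  shows "(nmono (App \<mu> \<nu>) - right_action X1 \<nu> (nmono \<mu>) :: ('k::field, 'x) nalg)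
    \<in> combs_upto (X0 \<union> X1) (leibniz_rels X0 X1) (App \<mu> \<nu>)"
  using assms
proof (induction \<nu> arbitrary: \<mu>)
  case (Letter a)
  then show ?case by (simp add: subspace_combs_upto nalg.subspace_0)
next
  case (App \<alpha> \<beta>)
  let ?X = "X0 \<union> X1" and ?S = "leibniz_rels X0 X1 :: ('k, 'x) nalg set"
  let ?V = "combs_upto ?X ?S (App \<mu> (App \<alpha> \<beta>))"
  have in_X: "\<alpha> \<in> nterms ?X" "\<beta> \<in> nterms ?X" using App.prems by (auto simp: nterms_def)
  \<comment> \<open>One claim for both orders of the factors: the supercommutator needs
    \<open>\<alpha>\<close> before \<open>\<beta>\<close> and \<open>\<beta>\<close> before
    \<open>\<alpha>\<close>.\<close>
  have step: "nmono (App (App \<mu> \<gamma>) \<delta>) - right_action X1 \<delta> (right_action X1 \<gamma> (nmono \<mu>)) \<in> ?V"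
    if eq: "{\<gamma>, \<delta>} = {\<alpha>, \<beta>}" for \<gamma> \<delta>
  proof -
    have mem: "\<gamma> \<in> {\<alpha>, \<beta>}" "\<delta> \<in> {\<alpha>, \<beta>}" unfolding eq[symmetric] by simp_all
    have \<gamma>\<delta>: "\<gamma> \<in> nterms ?X" "\<delta> \<in> nterms ?X" using mem in_X by auto
    have IH: "(nmono (App \<rho> \<kappa>) - right_action X1 \<kappa> (nmono \<rho>) :: ('k, 'x) nalg) \<in> combs_upto ?X ?S (App \<rho> \<kappa>)"
      if "\<rho> \<in> nterms ?X" "\<kappa> \<in> {\<alpha>, \<beta>}" for \<rho> \<kappa>
      using that App.IH(1)[of \<rho>] App.IH(2)[of \<rho>] in_X by auto
    let ?f = "right_action X1 \<gamma> (nmono \<mu>) :: ('k, 'x) nalg"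
    \<comment> \<open>The total length equals that of
      \<open>App \<mu> (App \<alpha> \<beta>)\<close>, while the right factor
      \<open>\<delta>\<close> is only one part of \<open>App \<alpha> \<beta>\<close>.\<close>
    have le: "nle (App \<rho> \<delta>) (App \<mu> (App \<alpha> \<beta>))" if "len \<rho> = len \<mu> + len \<gamma>" for \<rho>
      using that eq len_pos[of \<alpha>] len_pos[of \<beta>] by (intro disjI1 nless_rotate) (auto simp: doubleton_eq_iff)
    have "nmult (nmono (App \<mu> \<gamma>) - ?f) (nmono \<delta>) \<in> combs_upto ?X ?S (App (App \<mu> \<gamma>) \<delta>)"
      by (rule combs_upto_mult_right[OF leibniz_rels_monic_lead IH[OF App.prems(1) mem(1)] \<gamma>\<delta>(2)])
    then have 1: "nmult (nmono (App \<mu> \<gamma>) - ?f) (nmono \<delta>) \<in> ?V"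
      by (rule rev_subsetD[OF _ combs_upto_mono[OF le]]) simp
    \<comment> \<open>The induction hypothesis for \<open>\<delta>\<close> is needed at every word
      of \<open>?f\<close>, which is why the left factor is arbitrary in the induction. All these
      words have the same length, so \<open>le\<close> bounds them uniformly.\<close>
    have 2: "nmult ?f (nmono \<delta>) - right_action X1 \<delta> ?f \<in> ?V"
    proof (rule reduce_right_mult_keys[OF _ subspace_combs_upto])
      fix \<rho> assume "\<rho> \<in> Poly_Mapping.keys ?f"
      then obtain \<kappa> where "\<kappa> \<in> Poly_Mapping.keys (nmono \<mu> :: ('k, 'x) nalg)" "reduct_of \<rho> (App \<kappa> \<gamma>)"
        by (rule keys_right_action)
      then have \<rho>: "len \<rho> = len \<mu> + len \<gamma>" "\<rho> \<in> nterms ?X"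
        using App.prems(1) \<gamma>\<delta> by (auto simp: nterms_def reduct_of_def)
      show "nmono (App \<rho> \<delta>) - right_action X1 \<delta> (nmono \<rho>) \<in> ?V"
        using IH[OF \<rho>(2) mem(2)] combs_upto_mono[OF le[OF \<rho>(1)]] by (rule rev_subsetD)
    qed
    \<comment> \<open>Insert the intermediate element \<open>nmult ?f (nmono \<delta>)\<close>:
      first \<open>\<gamma>\<close> is turned into an action, then \<open>\<delta>\<close>.\<close>
    have "nmono (App (App \<mu> \<gamma>) \<delta>) - right_action X1 \<delta> ?f =
        nmult (nmono (App \<mu> \<gamma>) - ?f) (nmono \<delta>) + (nmult ?f (nmono \<delta>) - right_action X1 \<delta> ?f)"
      by (simp add: module_hom.diff[OF nalg_hom_nmult_left])
    then show ?thesis using nalg.subspace_add[OF subspace_combs_upto 1 2] by (simp only:)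
  qed
  \<comment> \<open>The relation itself is a generator, obtained from the star term that is a bare
    star.\<close>
  have rel: "leibniz_rel X1 \<mu> \<alpha> \<beta> \<in> ?V"
  proof -
    have "Letter None \<in> star_terms ?X" by (simp add: star_terms_def nterms_def)
    moreover have "leibniz_rel X1 \<mu> \<alpha> \<beta> \<in> ?S" using App.prems in_X by (auto simp: leibniz_rels_eq)
    moreover have "leading_term nless (leibniz_rel X1 \<mu> \<alpha> \<beta> :: ('k, 'x) nalg) = App \<mu> (App \<alpha> \<beta>)"
      by (rule leading_term_eq[OF monic_lead_leibniz_rel])
    ultimately show ?thesis
      unfolding combs_upto_def
      by (intro nalg.span_base CollectI exI[of _ "Letter None"] exI[of _ "leibniz_rel X1 \<mu> \<alpha> \<beta>"]) simp
  qed
  let ?c = "(-1) ^ (parity X1 \<alpha> * parity X1 \<beta>) :: 'k"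
  have "nmono (App \<mu> (App \<alpha> \<beta>)) - right_action X1 (App \<alpha> \<beta>) (nmono \<mu>) =
      leibniz_rel X1 \<mu> \<alpha> \<beta>
      + (nmono (App (App \<mu> \<alpha>) \<beta>) - right_action X1 \<beta> (right_action X1 \<alpha> (nmono \<mu>)))
      - nscale ?c (nmono (App (App \<mu> \<beta>) \<alpha>) - right_action X1 \<alpha> (right_action X1 \<beta> (nmono \<mu>)))"
    by (simp add: leibniz_rel_def nalg.scale_right_diff_distrib)
  also have "\<dots> \<in> ?V"
    by (intro nalg.subspace_add nalg.subspace_diff nalg.subspace_scale subspace_combs_upto rel step)
      (simp_all add: insert_commute)
  finally show ?case .
qed

text \<open>First the left factor is replaced by its normal form, then multiplication by
  \<open>\<nu>\<close> is replaced by its action. Compatibility of the order keeps both corrections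
  within the bound.\<close>

lemma reduce_normal_form:
  fixes X0 X1 :: "'x::wellorder set"
  assumes "\<mu> \<in> nterms (X0 \<union> X1)"
  shows "(nmono \<mu> - normal_form X1 \<mu> :: ('k::field, 'x) nalg)
    \<in> combs_upto (X0 \<union> X1) (leibniz_rels X0 X1) \<mu>"
  using assms
proof (induction \<mu>)
  case (Letter a)
  then show ?case by (simp add: subspace_combs_upto nalg.subspace_0)
next
  case (App \<mu> \<nu>)
  let ?X = "X0 \<union> X1" and ?S = "leibniz_rels X0 X1 :: ('k, 'x) nalg set"
  let ?V = "combs_upto ?X ?S (App \<mu> \<nu>)" and ?f = "normal_form X1 \<mu> :: ('k, 'x) nalg"
  have in_X: "\<mu> \<in> nterms ?X" "\<nu> \<in> nterms ?X" using App.prems by (auto simp: nterms_def)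
  have 1: "nmult (nmono \<mu> - ?f) (nmono \<nu>) \<in> ?V"
    by (rule combs_upto_mult_right[OF leibniz_rels_monic_lead App.IH(1)[OF in_X(1)] in_X(2)])
  have 2: "nmult ?f (nmono \<nu>) - right_action X1 \<nu> ?f \<in> ?V"
  proof (rule reduce_right_mult_keys[OF _ subspace_combs_upto])
    fix \<rho> assume "\<rho> \<in> Poly_Mapping.keys ?f"
    note \<rho> = keys_normal_form[OF this]
    then have "nle (App \<rho> \<nu>) (App \<mu> \<nu>)" by (intro nle_App_left) (simp add: reduct_of_def)
    moreover have "\<rho> \<in> nterms ?X" using \<rho> in_X by (simp add: nterms_def reduct_of_def)
    ultimately show "nmono (App \<rho> \<nu>) - right_action X1 \<nu> (nmono \<rho>) \<in> ?V"
      using rev_subsetD[OF reduce_right_mult[of \<rho> X0 X1 \<nu>] combs_upto_mono] in_X(2) by blast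
  qed
  have "nmono (App \<mu> \<nu>) - normal_form X1 (App \<mu> \<nu>) =
      nmult (nmono \<mu> - ?f) (nmono \<nu>) + (nmult ?f (nmono \<nu>) - right_action X1 \<nu> ?f)"
    by (simp add: module_hom.diff[OF nalg_hom_nmult_left])
  then show ?case using nalg.subspace_add[OF subspace_combs_upto 1 2] by (simp only:)
qed

lemma reduce_linext:
  "f - linext (normal_form X1) f = linext (\<lambda>\<mu>. nmono \<mu> - normal_form X1 \<mu>) f"
  by (simp add: linext_diff_fun linext_nmono)

section \<open>The Leibniz ideal\<close>

lemma carrier_free_nalg: "f \<in> carrier (free_nalg X) \<longleftrightarrow> Poly_Mapping.keys f \<subseteq> nterms X"
  by (simp add: free_nalg_def)

lemma nmult_carrier:
  "f \<in> carrier (free_nalg X) \<Longrightarrow> g \<in> carrier (free_nalg X) \<Longrightarrow> nmult f g \<in> carrier (free_nalg X)"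
  using keys_nmult[of f g] by (fastforce simp: carrier_free_nalg nterms_def)

lemma subspace_keys: "nalg.subspace {f. Poly_Mapping.keys f \<subseteq> B}"
  unfolding nalg.subspace_def
proof (intro conjI ballI allI)
  fix f g :: "('a, 'b) nalg" assume "f \<in> {f. Poly_Mapping.keys f \<subseteq> B}" "g \<in> {f. Poly_Mapping.keys f \<subseteq> B}"
  then show "f + g \<in> {f. Poly_Mapping.keys f \<subseteq> B}" using Poly_Mapping.keys_add[of f g] by auto
next
  fix c and f :: "('a, 'b) nalg" assume "f \<in> {f. Poly_Mapping.keys f \<subseteq> B}"
  then show "nscale c f \<in> {f. Poly_Mapping.keys f \<subseteq> B}" by (auto simp: in_keys_iff)
qed simp

lemma subspace_carrier: "nalg.subspace (carrier (free_nalg X))"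
  using subspace_keys by (simp add: free_nalg_def)

lemma nmono_carrier: "\<mu> \<in> nterms X \<Longrightarrow> nmono \<mu> \<in> carrier (free_nalg X)"
  by (simp add: carrier_free_nalg)

text \<open>The type-based notion of subspace does not know \<open>X\<close>, so containment in the
  carrier appears as a separate condition.\<close>

lemma subspace_free_nalg_iff:
  "VectorSpace.subspace class_ring I (free_nalg X) \<longleftrightarrow> nalg.subspace I \<and> I \<subseteq> carrier (free_nalg X)"
proof -
  interpret A: vectorspace class_ring "free_nalg X :: ('a, ('a, 'b) nalg) module"
    by (rule vectorspace_free_nalg)
  have ops: "x \<oplus>\<^bsub>free_nalg X\<^esub> y = x + y" "c \<odot>\<^bsub>free_nalg X\<^esub> x = nscale c x" "\<zero>\<^bsub>free_nalg X\<^esub> = (0 :: ('a, 'b) nalg)"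
    for c and x y :: "('a, 'b) nalg"
    by (simp_all add: free_nalg_def)
  show ?thesis
    by (auto simp: VectorSpace.subspace_def LinearCombinations.submodule_def nalg.subspace_def
        A.vectorspace_axioms A.module_axioms ops class_ring_simps)
qed

lemma two_sided_ideal_free_nalg_iff:
  "two_sided_ideal (free_nalg X) I \<longleftrightarrow> nalg.subspace I \<and> I \<subseteq> carrier (free_nalg X) \<and>
    (\<forall>g\<in>carrier (free_nalg X). \<forall>f\<in>I. nmult g f \<in> I \<and> nmult f g \<in> I)"
  unfolding two_sided_ideal_def subspace_free_nalg_iff by (simp add: free_nalg_def)

lemmas leibniz_ideal_props = leibniz_ideal[unfolded two_sided_ideal_free_nalg_iff]

lemma leibniz_rels_kernel: "leibniz_rels X0 X1 \<subseteq> nf_kernel X1"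
  unfolding leibniz_rels_eq using leibniz_rel_in_kernel by blast

text \<open>By minimality of the generated ideal. The kernel is cut down to the carrier because it
  may involve letters outside \<open>X0 \<union> X1\<close>.\<close>

lemma leibniz_ideal_kernel: "leibniz_ideal X0 X1 \<subseteq> nf_kernel X1"
proof -
  let ?A = "carrier (free_nalg (X0 \<union> X1))"
  have "two_sided_ideal (free_nalg (X0 \<union> X1)) (nf_kernel X1 \<inter> ?A)"
    unfolding two_sided_ideal_free_nalg_iff
    by (auto simp: nf_kernel_mult_left nf_kernel_mult_right nmult_carrier
        intro: nalg.subspace_inter subspace_nf_kernel subspace_carrier)
  then have "leibniz_ideal X0 X1 \<subseteq> nf_kernel X1 \<inter> ?A"
    unfolding leibniz_ideal_def generated_ideal_def
    using leibniz_rels_kernel rels_carrier by (intro hull_minimal) blast+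
  then show ?thesis by blast
qed

lemma star_subst_carrier:
  "f \<in> carrier (free_nalg X) \<Longrightarrow> \<sigma> \<in> star_terms X \<Longrightarrow> star_subst \<sigma> f \<in> carrier (free_nalg X)"
  by (rule star_subst_in_ideal[where A = "carrier (free_nalg X)"])
    (auto simp: nmult_carrier carrier_free_nalg[of "nmono _"] nterms_def)

lemma combs_upto_ideal:
  fixes X0 X1 :: "'x::wellorder set"
  shows "combs_upto (X0 \<union> X1) (leibniz_rels X0 X1) \<mu> \<subseteq> (leibniz_ideal X0 X1 :: ('k::field, 'x) nalg set)"
  unfolding combs_upto_def
proof (intro nalg.span_minimal)
  let ?I = "leibniz_ideal X0 X1 :: ('k, 'x) nalg set"
  show "nalg.subspace ?I" using leibniz_ideal_props by blast
  have "leibniz_rels X0 X1 \<subseteq> ?I"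
    unfolding leibniz_ideal_def generated_ideal_def by (rule hull_subset)
  moreover have "star_subst \<sigma> s \<in> ?I" if "s \<in> ?I" "\<sigma> \<in> star_terms (X0 \<union> X1)" for \<sigma> s
    using that leibniz_ideal_props[of X0 X1]
    by (intro star_subst_in_ideal[where A = "carrier (free_nalg (X0 \<union> X1))"])
      (auto simp: nmult_carrier carrier_free_nalg[of "nmono _"] nterms_def)
  ultimately show "{star_subst \<sigma> s |\<sigma> s. \<sigma> \<in> star_terms (X0 \<union> X1) \<and> s \<in> leibniz_rels X0 X1 \<and>
      nle (leading_term nless (star_subst \<sigma> s)) \<mu>} \<subseteq> ?I" by blast
qed

lemma reduce_in_ideal:
  fixes X0 X1 :: "'x::wellorder set" and f :: "('k::field, 'x) nalg"
  assumes "f \<in> carrier (free_nalg (X0 \<union> X1))"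
  shows "f - linext (normal_form X1) f \<in> leibniz_ideal X0 X1"
  unfolding reduce_linext
proof (rule linext_in_subspace)
  show "nalg.subspace (leibniz_ideal X0 X1 :: ('k, 'x) nalg set)" using leibniz_ideal_props by blast
  fix \<mu> assume "\<mu> \<in> Poly_Mapping.keys f"
  then have "\<mu> \<in> nterms (X0 \<union> X1)" using assms by (auto simp: carrier_free_nalg)
  then show "nmono \<mu> - normal_form X1 \<mu> \<in> (leibniz_ideal X0 X1 :: ('k, 'x) nalg set)"
    by (rule rev_subsetD[OF reduce_normal_form combs_upto_ideal])
qed

section \<open>The Groebner-Shirshov basis\<close>

lemma gs_basis_leibniz_rels:
  fixes X0 X1 :: "'x::wellorder set"
  shows "gs_basis nless (X0 \<union> X1) (leibniz_rels X0 X1 :: ('k::field, 'x) nalg set)"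
  unfolding gs_basis_def
proof (intro conjI ballI impI)
  let ?X = "X0 \<union> X1" and ?S = "leibniz_rels X0 X1 :: ('k, 'x) nalg set"
  show "?S \<subseteq> carrier (free_nalg ?X)" by (rule rels_carrier)
  show "nmonic nless s" if "s \<in> ?S" for s
  proof -
    obtain \<mu> where "monic_lead s \<mu>" using leibniz_rels_monic_lead[OF \<open>s \<in> ?S\<close>] by blast
    then show ?thesis using leading_term_eq[of s \<mu>] by (auto simp: nmonic_def monic_lead_def)
  qed
  fix f g :: "('k, 'x) nalg" and \<sigma>
  assume f: "f \<in> ?S" and g: "g \<in> ?S" and \<sigma>: "\<sigma> \<in> star_terms ?X"
    and eq: "leading_term nless f = leading_term nless (star_subst \<sigma> g)"
  define w where "w = leading_term nless f"
  \<comment> \<open>Pairs rather than substituted elements are collected, since the definition of a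
    Groebner-Shirshov basis asks for the star term and the relation separately.\<close>
  define B where "B = {(\<nu>, s). \<nu> \<in> star_terms ?X \<and> s \<in> ?S \<and> nless (leading_term nless (star_subst \<nu> s)) w}"
  define h where "h = f - star_subst \<sigma> g"
  have lf: "monic_lead f w"
    using leibniz_rels_monic_lead[OF f] leading_term_eq unfolding w_def by blast
  obtain \<mu> where "monic_lead g \<mu>" using leibniz_rels_monic_lead[OF g] by blast
  then have lg: "monic_lead (star_subst \<sigma> g) w"
    using monic_lead_star_subst[of g \<mu> \<sigma>] leading_term_eq unfolding w_def eq by blast
  have lt: "nless \<tau> w" "\<tau> \<in> nterms ?X" if "\<tau> \<in> Poly_Mapping.keys h" for \<tau>
  proof -
    \<comment> \<open>Both \<open>f\<close> and the substituted \<open>g\<close> have coefficient 1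
      at \<open>w\<close>, so this term cancels in \<open>h\<close>.\<close>
    have "\<tau> \<noteq> w" using that lf lg by (auto simp: h_def monic_lead_def in_keys_iff lookup_minus)
    moreover have \<tau>: "\<tau> \<in> Poly_Mapping.keys f \<or> \<tau> \<in> Poly_Mapping.keys (star_subst \<sigma> g)"
      using that by (auto simp: h_def in_keys_iff lookup_minus)
    ultimately show "nless \<tau> w" using lf lg by (auto simp: monic_lead_def)
    have "f \<in> carrier (free_nalg ?X)" "star_subst \<sigma> g \<in> carrier (free_nalg ?X)"
      using f g \<sigma> rels_carrier star_subst_carrier by blast+
    then show "\<tau> \<in> nterms ?X" using \<tau> by (auto simp: carrier_free_nalg)
  qed
  have "h \<in> nf_kernel X1"
    unfolding h_def using f g \<sigma> leibniz_rels_kernel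
    by (intro nalg.subspace_diff[OF subspace_nf_kernel] star_subst_in_kernel) blast+
  \<comment> \<open>The normal form of \<open>h\<close> is zero, so \<open>h\<close> equals
    \<open>h\<close> minus its normal form, taken word by word.\<close>
  then have "h = linext (\<lambda>\<mu>. nmono \<mu> - normal_form X1 \<mu>) h"
    unfolding reduce_linext[symmetric] by (simp add: nf_kernel_def)
  also have "\<dots> \<in> nalg.span ((\<lambda>(\<nu>, s). star_subst \<nu> s) ` B)"
  proof (intro linext_in_subspace nalg.subspace_span)
    fix \<tau> assume "\<tau> \<in> Poly_Mapping.keys h"
    note \<tau> = lt[OF this]
    \<comment> \<open>Generators bounded weakly by \<open>\<tau>\<close> are bounded strictly by
      \<open>w\<close>, because \<open>\<tau>\<close> is strictly below \<open>w\<close>.\<close>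
    have "combs_upto ?X ?S \<tau> \<subseteq> nalg.span ((\<lambda>(\<nu>, s). star_subst \<nu> s) ` B)"
      unfolding combs_upto_def
    proof (intro nalg.span_mono subsetI)
      fix x assume "x \<in> {star_subst \<sigma> s |\<sigma> s. \<sigma> \<in> star_terms ?X \<and> s \<in> ?S \<and>
        nle (leading_term nless (star_subst \<sigma> s)) \<tau>}"
      then obtain \<nu> s where x: "x = star_subst \<nu> s" "\<nu> \<in> star_terms ?X" "s \<in> ?S"
        and "nle (leading_term nless (star_subst \<nu> s)) \<tau>" by blast
      then have "nless (leading_term nless (star_subst \<nu> s)) w"
        using \<tau>(1) nless_trans[of _ \<tau> w] by auto
      then have "(\<nu>, s) \<in> B" using x by (simp add: B_def)
      then show "x \<in> (\<lambda>(\<nu>, s). star_subst \<nu> s) ` B" using x by (intro image_eqI[of _ _ "(\<nu>, s)"]) simp_all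
    qed
    then show "nmono \<tau> - normal_form X1 \<tau> \<in> nalg.span ((\<lambda>(\<nu>, s). star_subst \<nu> s) ` B)"
      using reduce_normal_form[OF \<tau>(2)] by blast
  qed
  finally obtain T r where T: "finite T" "T \<subseteq> (\<lambda>(\<nu>, s). star_subst \<nu> s) ` B" and h: "h = (\<Sum>x\<in>T. nscale (r x) x)"
    unfolding nalg.span_explicit by blast
  \<comment> \<open>The span yields a sum over a finite set of elements. It is enumerated to obtain
    a sum over an initial segment of the naturals, and \<open>p\<close> chooses a star term and a
    relation for each element.\<close>
  obtain e where e: "bij_betw e {..<card T} T"
    using ex_bij_betw_nat_finite[OF T(1)] by (auto simp: atLeast0LessThan)
  define p where "p x = (SOME p. p \<in> B \<and> x = star_subst (fst p) (snd p))" for x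
  have p: "p x \<in> B" "x = star_subst (fst (p x)) (snd (p x))" if "x \<in> T" for x
  proof -
    have "\<exists>q. q \<in> B \<and> x = star_subst (fst q) (snd q)" using that T(2) unfolding case_prod_beta by blast
    from someI_ex[OF this] show "p x \<in> B" "x = star_subst (fst (p x)) (snd (p x))"
      unfolding p_def by blast+
  qed
  have eT: "e i \<in> T" if "i < card T" for i using e that by (auto simp: bij_betw_def)
  have "h = (\<Sum>i<card T. nscale (r (e i)) (e i))"
    unfolding h by (rule sum.reindex_bij_betw[OF e, symmetric])
  also have "\<dots> = (\<Sum>i<card T. nscale (r (e i)) (star_subst (fst (p (e i))) (snd (p (e i)))))"
    using p(2)[OF eT] by (intro sum.cong) simp_all
  finally have sum: "h = (\<Sum>i<card T. nscale (r (e i)) (star_subst (fst (p (e i))) (snd (p (e i)))))" .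
  have B: "fst (p (e i)) \<in> star_terms ?X \<and> snd (p (e i)) \<in> ?S \<and>
      nless (leading_term nless (star_subst (fst (p (e i))) (snd (p (e i))))) w" if "i < card T" for i
    using p(1)[OF eT[OF that]] by (auto simp: B_def case_prod_beta)
  show "\<exists>(n::nat) \<alpha> \<nu> s.
      (\<forall>i<n. \<nu> i \<in> star_terms ?X \<and> s i \<in> ?S \<and>
        nless (leading_term nless (star_subst (\<nu> i) (s i))) (leading_term nless f)) \<and>
      f - star_subst \<sigma> g = (\<Sum>i<n. nscale (\<alpha> i) (star_subst (\<nu> i) (s i)))"
    using B sum unfolding h_def w_def
    by (intro exI[of _ "card T"] exI[of _ "\<lambda>i. r (e i)"] exI[of _ "\<lambda>i. fst (p (e i))"]
        exI[of _ "\<lambda>i. snd (p (e i))"]) simp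
qed

section \<open>The linear basis\<close>

lemma NF_Letter: "a \<in> X \<Longrightarrow> Letter a \<in> NF X"
  unfolding NF_def by (intro CollectI exI[of _ "[a]"]) simp

lemma left_normed_snoc: "\<mu>s \<noteq> [] \<Longrightarrow> left_normed (\<mu>s @ [\<mu>]) = App (left_normed \<mu>s) \<mu>"
  by (cases \<mu>s) auto

lemma NF_App: "\<mu> \<in> NF X \<Longrightarrow> a \<in> X \<Longrightarrow> App \<mu> (Letter a) \<in> NF X"
  unfolding NF_def
proof clarify
  fix as assume "as \<noteq> []" "set as \<subseteq> X" "a \<in> X"
  then show "\<exists>bs. App (left_normed (map Letter as)) (Letter a) = left_normed (map Letter bs) \<and> bs \<noteq> [] \<and> set bs \<subseteq> X"
    by (intro exI[of _ "as @ [a]"]) (simp add: left_normed_snoc)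
qed

text \<open>Left-normed words grow at their right end, so the list of letters is decomposed from the
  right.\<close>

lemma NF_induct [consumes 1, case_names Letter App]:
  assumes "\<mu> \<in> NF X" "\<And>a. a \<in> X \<Longrightarrow> P (Letter a)"
    and "\<And>\<mu> a. \<mu> \<in> NF X \<Longrightarrow> P \<mu> \<Longrightarrow> a \<in> X \<Longrightarrow> P (App \<mu> (Letter a))"
  shows "P \<mu>"
proof -
  have "P (left_normed (map Letter as))" if "as \<noteq> []" "set as \<subseteq> X" for as
    using that
  proof (induction as rule: rev_nonempty_induct)
    case (snoc a as)
    then have "left_normed (map Letter as) \<in> NF X" unfolding NF_def by auto
    then show ?case using snoc assms(3) by (simp add: left_normed_snoc)
  qed (simp add: assms(2))
  then show ?thesis using assms(1) by (auto simp: NF_def)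
qed

lemma NF_subset_nterms: "NF X \<subseteq> nterms X"
proof
  fix \<mu> assume "\<mu> \<in> NF X"
  then show "\<mu> \<in> nterms X" by (induction rule: NF_induct) (auto simp: nterms_def)
qed

text \<open>Every right factor in a left-normed word is a letter, which acts by plain
  multiplication, so nothing is rewritten.\<close>

lemma normal_form_NF: "\<mu> \<in> NF X \<Longrightarrow> normal_form X1 \<mu> = nmono \<mu>"
  by (induction rule: NF_induct) simp_all

text \<open>The action is composed of right multiplications by letters, under which left-normed
  words are stable.\<close>

lemma keys_right_action_NF:
  "Poly_Mapping.keys f \<subseteq> NF X \<Longrightarrow> \<nu> \<in> nterms X \<Longrightarrow> Poly_Mapping.keys (right_action X1 \<nu> f) \<subseteq> NF X"
proof (induction \<nu> arbitrary: f)
  case (Letter a)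
  then show ?case using keys_nmult[of f "nmono (Letter a)"] NF_App[of _ X a] by (auto simp: nterms_def)
next
  case (App \<mu> \<nu>)
  then have "\<mu> \<in> nterms X" "\<nu> \<in> nterms X" by (simp_all add: nterms_def)
  then have "Poly_Mapping.keys (right_action X1 \<nu> (right_action X1 \<mu> f)) \<subseteq> NF X"
    "Poly_Mapping.keys (right_action X1 \<mu> (right_action X1 \<nu> f)) \<subseteq> NF X"
    using App by simp_all
  then show ?case unfolding right_action.simps using keys_diff_scale by blast
qed

lemma keys_normal_form_NF: "\<mu> \<in> nterms X \<Longrightarrow> Poly_Mapping.keys (normal_form X1 \<mu>) \<subseteq> NF X"
  by (induction \<mu>) (simp_all add: nterms_def NF_Letter keys_right_action_NF)

lemma linext_normal_form_NF:
  "Poly_Mapping.keys f \<subseteq> NF X \<Longrightarrow> linext (normal_form X1) f = f"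
proof -
  assume "Poly_Mapping.keys f \<subseteq> NF X"
  then have "linext (normal_form X1) f = linext nmono f"
    unfolding linext_def by (intro sum.cong) (auto simp: normal_form_NF)
  then show ?thesis by (simp add: linext_nmono)
qed

lemma keys_linext_normal_form:
  fixes f :: "('k::field, 'x) nalg"
  assumes "f \<in> carrier (free_nalg X)"
  shows "Poly_Mapping.keys (linext (normal_form X1) f) \<subseteq> NF X"
proof -
  have "linext (normal_form X1) f \<in> {g. Poly_Mapping.keys g \<subseteq> NF X}"
  proof (rule linext_in_subspace)
    show "nalg.subspace {g :: ('k, 'x) nalg. Poly_Mapping.keys g \<subseteq> NF X}"
      by (rule subspace_keys)
    show "normal_form X1 \<mu> \<in> {g. Poly_Mapping.keys g \<subseteq> NF X}" if "\<mu> \<in> Poly_Mapping.keys f" for \<mu>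
      using that assms keys_normal_form_NF[of \<mu> X X1] by (auto simp: carrier_free_nalg)
  qed
  then show ?thesis by simp
qed

text \<open>The core of linear independence: the normal form map vanishes on the ideal and fixes
  combinations of left-normed words.\<close>

lemma NF_ideal_trivial:
  assumes "f \<in> leibniz_ideal X0 X1" "Poly_Mapping.keys f \<subseteq> NF X"
  shows "f = 0"
  using assms leibniz_ideal_kernel[of X0 X1] linext_normal_form_NF[of f X X1] by (auto simp: nf_kernel_def)

section \<open>The projection onto the quotient and its linearity\<close>

definition Lbs_proj :: "'x set \<Rightarrow> 'x set \<Rightarrow> ('k::field, 'x) nalg \<Rightarrow> ('k, 'x) nalg set" where
  "Lbs_proj X0 X1 f = leibniz_ideal X0 X1 +>\<^bsub>free_nalg (X0 \<union> X1) :: ('k, ('k, 'x) nalg) module\<^esub> f"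

lemma Lbs_class_eq_proj: "Lbs_class X0 X1 \<mu> = Lbs_proj X0 X1 (nmono \<mu>)"
  by (simp add: Lbs_class_def Lbs_proj_def)

context
  fixes X0 X1 :: "'x set"
begin

private abbreviation A :: "('k::field, ('k, 'x) nalg) module" where
  "A \<equiv> free_nalg (X0 \<union> X1)"

private abbreviation I :: "('k::field, 'x) nalg set" where
  "I \<equiv> leibniz_ideal X0 X1"

private lemma subspace_I: "VectorSpace.subspace class_ring I A"
  using leibniz_ideal two_sided_ideal_def by blast

lemma Lbs_proj_eq_iff:
  fixes f g :: "('k::field, 'x) nalg"
  assumes "f \<in> carrier A" "g \<in> carrier A"
  shows "Lbs_proj X0 X1 f = Lbs_proj X0 X1 g \<longleftrightarrow> f - g \<in> I"
proof -
  interpret A: vectorspace class_ring "A :: ('k, ('k, 'x) nalg) module" by (rule vectorspace_free_nalg)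
  have "f - g \<in> carrier A" by (rule nalg.subspace_diff[OF subspace_carrier assms])
  \<comment> \<open>Identifies subtraction in the record, defined through its own inverses, with
    subtraction of the type.\<close>
  have "f = (f - g) \<oplus>\<^bsub>A\<^esub> g" by (simp add: free_nalg_def)
  then have "f \<ominus>\<^bsub>A\<^esub> g = f - g"
    using assms \<open>f - g \<in> carrier A\<close> by (metis A.add.inv_solve_right' A.minus_eq)
  then show ?thesis
    using vectorspace_quotient(2)[OF subspace_I assms] by (simp add: Lbs_proj_def)
qed

lemma Lbs_proj_scale:
  fixes f :: "('k::field, 'x) nalg"
  assumes "f \<in> carrier A"
  shows "c \<odot>\<^bsub>Lbs X0 X1\<^esub> Lbs_proj X0 X1 f = Lbs_proj X0 X1 (nscale c f)"
  using vectorspace_quotient(3)[OF subspace_I assms, of c]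
  unfolding Lbs_def Lbs_proj_def by (simp add: free_nalg_def)

lemma Lbs_proj_add:
  fixes f g :: "('k::field, 'x) nalg"
  assumes "f \<in> carrier A" "g \<in> carrier A"
  shows "Lbs_proj X0 X1 f \<oplus>\<^bsub>Lbs X0 X1\<^esub> Lbs_proj X0 X1 g = Lbs_proj X0 X1 (f + g)"
proof -
  interpret A: vectorspace class_ring "A :: ('k, ('k, 'x) nalg) module" by (rule vectorspace_free_nalg)
  have sg: "additive_subgroup I (A :: ('k, ('k, 'x) nalg) module)"
  proof (rule additive_subgroup.intro, rule A.add.subgroupI)
    have I: "nalg.subspace (I :: ('k, 'x) nalg set)" "(I :: ('k, 'x) nalg set) \<subseteq> carrier A"
      using leibniz_ideal_props by blast+
    show "(I :: ('k, 'x) nalg set) \<subseteq> carrier A" by (rule I)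
    show "(I :: ('k, 'x) nalg set) \<noteq> {}" using nalg.subspace_0[OF I(1)] by blast
    show "x \<oplus>\<^bsub>A\<^esub> y \<in> I" if "x \<in> I" "y \<in> I" for x y :: "('k, 'x) nalg"
      using nalg.subspace_add[OF I(1) that] by (simp add: free_nalg_def)
    show "\<ominus>\<^bsub>A\<^esub> x \<in> I" if "x \<in> I" for x :: "('k, 'x) nalg"
    proof -
      have "- x \<in> I" by (rule nalg.subspace_neg[OF I(1) that])
      moreover have "\<ominus>\<^bsub>A\<^esub> x = - x"
        using I(2) that \<open>- x \<in> I\<close> by (intro A.minus_equality) (auto simp: free_nalg_def)
      ultimately show ?thesis by simp
    qed
  qed
  interpret Q: abelian_subgroup I "A :: ('k, ('k, 'x) nalg) module"
    by (rule abelian_subgroupI3[OF sg A.abelian_group_axioms])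
  show ?thesis
    using Q.a_rcos_sum[OF assms] by (simp add: Lbs_def Lbs_proj_def quotient_nalg_def free_nalg_def)
qed

lemma Lbs_proj_zero: "\<zero>\<^bsub>Lbs X0 X1\<^esub> = Lbs_proj X0 X1 (0 :: ('k::field, 'x) nalg)"
proof -
  interpret A: vectorspace class_ring "A :: ('k, ('k, 'x) nalg) module" by (rule vectorspace_free_nalg)
  have "(I :: ('k, 'x) nalg set) \<subseteq> carrier A" using leibniz_ideal_props by blast
  from A.a_coset_add_zero[OF this] show ?thesis
    by (simp add: Lbs_def Lbs_proj_def quotient_nalg_def free_nalg_def)
qed

lemma carrier_Lbs: "carrier (Lbs X0 X1) = Lbs_proj X0 X1 ` carrier (A :: ('k::field, ('k, 'x) nalg) module)"
  by (auto simp: Lbs_def quotient_nalg_def A_RCOSETS_def' Lbs_proj_def)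

text \<open>Lifts a linear combination of classes to a single polynomial, for which equality in the
  quotient becomes membership in the ideal.\<close>

lemma Lbs_finsum:
  fixes c :: "'x nterm \<Rightarrow> 'k::field"
  assumes "finite T" "T \<subseteq> nterms (X0 \<union> X1)"
  shows "(\<Oplus>\<^bsub>Lbs X0 X1\<^esub>\<mu>\<in>T. c \<mu> \<odot>\<^bsub>Lbs X0 X1\<^esub> Lbs_class X0 X1 \<mu>) =
    Lbs_proj X0 X1 (\<Sum>\<mu>\<in>T. Poly_Mapping.single \<mu> (c \<mu>))"
proof -
  interpret L: vectorspace class_ring "Lbs X0 X1 :: ('k, ('k, 'x) nalg set) module" by (rule vectorspace_Lbs)
  have scal: "c \<mu> \<odot>\<^bsub>Lbs X0 X1\<^esub> Lbs_class X0 X1 \<mu> = Lbs_proj X0 X1 (Poly_Mapping.single \<mu> (c \<mu>))"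
    if "\<mu> \<in> nterms (X0 \<union> X1)" for \<mu>
    using that by (simp add: Lbs_class_eq_proj Lbs_proj_scale nmono_carrier)
  have carr: "Poly_Mapping.single \<mu> (c \<mu>) \<in> carrier A" if "\<mu> \<in> nterms (X0 \<union> X1)" for \<mu>
    using that by (simp add: carrier_free_nalg)
  have "(\<Oplus>\<^bsub>Lbs X0 X1\<^esub>\<mu>\<in>T. Lbs_proj X0 X1 (Poly_Mapping.single \<mu> (c \<mu>))) =
    Lbs_proj X0 X1 (\<Sum>\<mu>\<in>T. Poly_Mapping.single \<mu> (c \<mu>))"
    using assms
  proof (induction T rule: finite_induct)
    case empty
    then show ?case by (simp add: Lbs_proj_zero)
  next
    case (insert \<mu> T)
    have "(\<lambda>\<mu>. Lbs_proj X0 X1 (Poly_Mapping.single \<mu> (c \<mu>))) \<in> insert \<mu> T \<rightarrow> carrier (Lbs X0 X1)"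
      using insert.prems carr by (auto simp: carrier_Lbs)
    moreover have "(\<Sum>\<mu>\<in>T. Poly_Mapping.single \<mu> (c \<mu>)) \<in> carrier A"
      using insert.prems carr by (intro nalg.subspace_sum[OF subspace_carrier]) auto
    ultimately show ?case
      using insert carr by (simp add: L.M.finsum_insert Lbs_proj_add)
  qed
  moreover have "(\<Oplus>\<^bsub>Lbs X0 X1\<^esub>\<mu>\<in>T. c \<mu> \<odot>\<^bsub>Lbs X0 X1\<^esub> Lbs_class X0 X1 \<mu>) =
      (\<Oplus>\<^bsub>Lbs X0 X1\<^esub>\<mu>\<in>T. Lbs_proj X0 X1 (Poly_Mapping.single \<mu> (c \<mu>)))"
    using assms(2) scal carr by (intro L.M.finsum_cong') (auto simp: carrier_Lbs)
  ultimately show ?thesis by simp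
qed

end

text \<open>The difference of two left-normed words with the same class is a combination of
  left-normed words in the ideal, hence zero. A basis statement about the set of classes alone would
  not separate the words.\<close>

lemma inj_on_Lbs_class:
  "inj_on (Lbs_class X0 X1 :: 'x nterm \<Rightarrow> ('k::field, 'x) nalg set) (NF (X0 \<union> X1))"
proof (rule inj_onI)
  fix \<mu> \<nu> assume NF: "\<mu> \<in> NF (X0 \<union> X1)" "\<nu> \<in> NF (X0 \<union> X1)"
    and eq: "(Lbs_class X0 X1 \<mu> :: ('k, 'x) nalg set) = Lbs_class X0 X1 \<nu>"
  let ?f = "nmono \<mu> - nmono \<nu> :: ('k, 'x) nalg"
  have "?f \<in> leibniz_ideal X0 X1"
    using eq NF NF_subset_nterms[of "X0 \<union> X1"]
    by (simp add: Lbs_class_eq_proj Lbs_proj_eq_iff nmono_carrier subset_iff)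
  moreover have "Poly_Mapping.keys ?f \<subseteq> NF (X0 \<union> X1)"
    using NF by (auto simp: in_keys_iff lookup_minus lookup_single when_def split: if_splits)
  ultimately have "?f = 0" by (rule NF_ideal_trivial)
  then have "nmono \<mu> = (nmono \<nu> :: ('k, 'x) nalg)" by simp
  then have "Poly_Mapping.keys (nmono \<mu> :: ('k, 'x) nalg) = Poly_Mapping.keys (nmono \<nu> :: ('k, 'x) nalg)" by simp
  then show "\<mu> = \<nu>" by simp
qed

lemma basis_Lbs:
  fixes X0 X1 :: "'x::wellorder set"
  shows "vectorspace.basis class_ring (Lbs X0 X1 :: ('k::field, ('k, 'x) nalg set) module)
    (Lbs_class X0 X1 ` NF (X0 \<union> X1))"
proof -
  let ?L = "Lbs X0 X1 :: ('k, ('k, 'x) nalg set) module" and ?N = "NF (X0 \<union> X1)"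
  let ?c = "Lbs_class X0 X1 :: 'x nterm \<Rightarrow> ('k, 'x) nalg set"
  interpret L: vectorspace class_ring ?L by (rule vectorspace_Lbs)
  \<comment> \<open>Linear combinations are indexed by classes; injectivity allows reindexing by the
    left-normed words themselves.\<close>
  have lincomb: "L.lincomb a (?c ` T) = Lbs_proj X0 X1 (\<Sum>\<mu>\<in>T. Poly_Mapping.single \<mu> (a (?c \<mu>)))"
    if "finite T" "T \<subseteq> ?N" for a T
  proof -
    have T: "T \<subseteq> nterms (X0 \<union> X1)" using that NF_subset_nterms by blast
    then have "?c ` T \<subseteq> carrier ?L"
      by (auto simp: carrier_Lbs Lbs_class_eq_proj nmono_carrier)
    then have "L.lincomb a (?c ` T) = (\<Oplus>\<^bsub>?L\<^esub>\<mu>\<in>T. a (?c \<mu>) \<odot>\<^bsub>?L\<^esub> ?c \<mu>)"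
      unfolding L.lincomb_def using inj_on_subset[OF inj_on_Lbs_class that(2)]
      by (intro L.M.finsum_reindex) (auto simp: class_ring_simps)
    then show ?thesis by (simp add: Lbs_finsum[OF that(1) T])
  qed
  have sub: "?c ` ?N \<subseteq> carrier ?L"
    using NF_subset_nterms by (force simp: carrier_Lbs Lbs_class_eq_proj nmono_carrier)
  have "L.lin_indpt (?c ` ?N)"
  proof
    assume "L.lin_dep (?c ` ?N)"
    then obtain U a v where U: "finite U" "U \<subseteq> ?c ` ?N" "L.lincomb a U = \<zero>\<^bsub>?L\<^esub>" "v \<in> U" "a v \<noteq> 0"
      unfolding L.lin_dep_def by (auto simp: class_ring_simps)
    obtain T where T: "finite T" "T \<subseteq> ?N" "U = ?c ` T"
      using finite_subset_image[OF U(1,2)] by blast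
    \<comment> \<open>The lift of the dependence to polynomials: its coefficients are exactly those
      of the dependence, so it must not vanish.\<close>
    let ?f = "\<Sum>\<mu>\<in>T. Poly_Mapping.single \<mu> (a (?c \<mu>))"
    have look: "Poly_Mapping.lookup ?f \<mu> = (if \<mu> \<in> T then a (?c \<mu>) else 0)" for \<mu>
      using T(1) by (simp add: lookup_sum lookup_single when_def)
    then have keys: "Poly_Mapping.keys ?f \<subseteq> ?N" using T(2) by (auto simp: in_keys_iff split: if_splits)
    then have carr: "?f \<in> carrier (free_nalg (X0 \<union> X1))"
      using NF_subset_nterms by (auto simp: carrier_free_nalg)
    have "Lbs_proj X0 X1 ?f = Lbs_proj X0 X1 0"
      using lincomb[OF T(1,2), of a] U(3) T(3) by (simp add: Lbs_proj_zero)
    then have "?f \<in> leibniz_ideal X0 X1"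
      using carr by (simp add: Lbs_proj_eq_iff carrier_free_nalg[of 0])
    then have "?f = 0" using keys by (rule NF_ideal_trivial)
    moreover obtain \<mu> where "\<mu> \<in> T" "v = ?c \<mu>" using U(4) T(3) by blast
    ultimately show False using look[of \<mu>] U(5) by simp
  qed
  moreover have "L.span (?c ` ?N) = carrier ?L"
  proof
    show "L.span (?c ` ?N) \<subseteq> carrier ?L" by (rule L.span_is_subset2[OF sub])
    show "carrier ?L \<subseteq> L.span (?c ` ?N)"
    proof
      fix v assume "v \<in> carrier ?L"
      then obtain f where f: "f \<in> carrier (free_nalg (X0 \<union> X1))" "v = Lbs_proj X0 X1 f"
        by (auto simp: carrier_Lbs)
      \<comment> \<open>The normal form represents the same class as \<open>f\<close> and involves
        only left-normed words.\<close>
      let ?g = "linext (normal_form X1) f"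
      let ?T = "Poly_Mapping.keys ?g"
      have T: "?T \<subseteq> ?N" by (rule keys_linext_normal_form[OF f(1)])
      then have "?g \<in> carrier (free_nalg (X0 \<union> X1))"
        using NF_subset_nterms by (auto simp: carrier_free_nalg)
      then have v: "v = Lbs_proj X0 X1 ?g"
        using f reduce_in_ideal by (simp add: Lbs_proj_eq_iff)
      \<comment> \<open>Coefficients must be a function of classes, so the class is traced back to
        its left-normed word. Only the values on classes of words in \<open>?T\<close>
        enter.\<close>
      define a where "a C = Poly_Mapping.lookup ?g (the_inv_into ?N ?c C)" for C
      have "a (?c \<mu>) = Poly_Mapping.lookup ?g \<mu>" if "\<mu> \<in> ?T" for \<mu>
        using that T by (auto simp: a_def the_inv_into_f_f[OF inj_on_Lbs_class])
      then have "(\<Sum>\<mu>\<in>?T. Poly_Mapping.single \<mu> (a (?c \<mu>))) = linext nmono ?g"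
        unfolding linext_def by (intro sum.cong) simp_all
      then have "v = L.lincomb a (?c ` ?T)"
        using lincomb[OF finite_keys T] v by (simp add: linext_nmono)
      then show "v \<in> L.span (?c ` ?N)"
        unfolding L.span_def using T
        by (intro CollectI exI[of _ a] exI[of _ "?c ` ?T"]) (auto simp: class_ring_simps)
    qed
  qed
  ultimately show ?thesis unfolding L.basis_def using sub by blast
qed

theorem theorem3p1:
  fixes X0 X1 :: "'x::wellorder set"
  assumes "X0 \<inter> X1 = {}"
  shows "gs_basis nless (X0 \<union> X1) (leibniz_rels X0 X1 :: ('k::field, 'x) nalg set) \<and>
    (inj_on (Lbs_class X0 X1 :: 'x nterm \<Rightarrow> ('k, 'x) nalg set) (NF (X0 \<union> X1)) \<and>
     vectorspace.basis class_ring (Lbs X0 X1 :: ('k, ('k, 'x) nalg set) module)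
       (Lbs_class X0 X1 ` NF (X0 \<union> X1)))"
  using gs_basis_leibniz_rels inj_on_Lbs_class basis_Lbs by blast

end
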